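(* Let $\beta\in(0,2]$, $L>0$ and $f_0\in\mathcal H^\beta(L)$. Let $(X,Y)=((X_i,Y_i))_{1\le i\le n}\sim P_{f_0}^n$ be data from the random design regression model. Let $\Pi$ be the overparameterized shallow ReLU network prior with $\alpha=0$ (so that the width is $N_0\asymp n$), $\sigma_n=n^{-t}$ with $t>2.5$, and $\zeta_k$ i.i.d. with the $p_n$-exponential density $h_{p_n}(u)\propto\exp(-|u|^{p_n}/p_n)$, where $p_n=2/\log n$, $n\ge8$. Let $\varepsilon_n^\ast=n^{-\frac\beta{1+2\beta}}$. For any $\rho\in(0,1)$ there exists a large enough constant $M>0$ such that, as $n\to\infty$, $$E_{f_0}\Pi_\rho\Big[\Big\{f:\ \tfrac1nD_\rho(P_f^n,P_{f_0}^n)\ge M\varepsilon_n^2\Big\}\ \Big|\ X,Y\Big]\to0$$ for any $\varepsilon_n\ge\varepsilon_n^\ast\sqrt{\log n}$. Assume further that $\|f_0\|_\infty\le F$ for some $F>0$, and let $\Pi_\rho^F[\,\cdot\mid X,Y]=\Pi_\rho[\,\cdot\mid X,Y]\circ T_F^{-1}$ with $T_F:f\mapsto-F\vee(f\wedge F)$ be the clipped $\rho$-posterior. Then for a large enough constant $M'>0$, as $n\to\infty$, $$E_{f_0}\Pi_\rho^F\big[\{f:\ \|f-f_0\|_{2,P_X}\ge M'\varepsilon_n\}\mid X,Y\big]\to0 .$$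
   Context: Random design regression: one observes i.i.d. pairs $(X_i,Y_i)\in[0,1]\times\mathbb R$, $Y_i=f(X_i)+\xi_i$, with $X_i$ i.i.d. from a distribution $P_X$ on $[0,1]$ and, independently, $\xi_i$ i.i.d. $\mathcal N(0,1)$. $P_f$ is the law of one pair, $P_f^n$ that of the sample, $E_{f_0}$ the expectation under $P_{f_0}^n$. For a prior $\Pi$ on $f$, the $\rho$-posterior is $\Pi_\rho[B\mid X,Y]=\int_Be^{\rho\ell_n(f)}d\Pi(f)/\int e^{\rho\ell_n(f)}d\Pi(f)$ with $\ell_n(f)=-\frac12\sum_{i=1}^n(Y_i-f(X_i))^2$. The loss is $\|f-f_0\|_{2,P_X}^2=\int(f-f_0)^2dP_X$. Hölder ball: for $\beta\in(0,2]$, with $\underline\beta\in\{0,1\}$ the largest integer strictly smaller than $\beta$, $\mathcal H^\beta(L)$ is the set of $f:[0,1]\to\mathbb R$ with $\max_{0\le i\le\underline\beta}\|D^if\|_\infty+\sup_{x\ne y}|D^{\underline\beta}f(x)-D^{\underline\beta}f(y)|/|x-y|^{\beta-\underline\beta}\le L$. Rényi divergence: $D_\rho(P,Q)=\frac1{\rho-1}\log\int(dP/dQ)^\rho dQ$. For $s\ge0$, $N_s=2^{m_s}$ where $m_s$ is the closest integer solution to $2^{m_s}=n^{1/(2s+1)}$; in particular $N_0=2^{m_0}$ with $2^{m_0}$ approximating $n$. Shallow ReLU network prior with parameter $\alpha$: $f(x)=\sum_{k=0}^{N_\alpha-1}w_k(x-a_k)_++b$, with $(u)_+=\max(u,0)$,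 $a_k=k/N_\alpha$ deterministic, $w_k=\sigma_n\zeta_k$ with $\zeta_k$ i.i.d., $\sigma_n>0$ deterministic, and $b\sim\pi_b$ independent of the weights, where $\pi_b$ has a symmetric, continuous, strictly positive density on $\mathbb R$. *)

theory Defs
  imports "HOL-Probability.Probability"
begin

text \<open>A function \<open>f : [0,1] \<rightarrow> \<real>\<close> is represented by a total function \<open>real \<Rightarrow> real\<close> of which only
  the values on \<open>[0,1]\<close> are ever used.\<close>

section \<open>Hoelder balls on the unit interval\<close>

definition D01 :: "(real \<Rightarrow> real) \<Rightarrow> real \<Rightarrow> real" where
  "D01 f x = vector_derivative f (at x within {0..1})"

text \<open>The largest integer strictly smaller than \<open>\<beta>\<close> (for \<open>\<beta> > 0\<close>).\<close>

definition strict_floor :: "real \<Rightarrow> nat" where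
  "strict_floor \<beta> = nat (\<lceil>\<beta>\<rceil> - 1)"

text \<open>The suprema are taken in \<open>ereal\<close>, so that they are \<open>\<infinity>\<close> when unbounded.\<close>

definition holder_norm :: "real \<Rightarrow> (real \<Rightarrow> real) \<Rightarrow> ereal" where
  "holder_norm \<beta> f = (let k = strict_floor \<beta> in
     Max ((\<lambda>i. SUP x\<in>{0..1}. ereal \<bar>(D01 ^^ i) f x\<bar>) ` {0..k})
     + (SUP (x, y)\<in>{(x, y). x \<in> {0..1} \<and> y \<in> {0..1} \<and> x \<noteq> y}.
          ereal (\<bar>(D01 ^^ k) f x - (D01 ^^ k) f y\<bar> / \<bar>x - y\<bar> powr (\<beta> - real k))))"

definition holder_ball :: "real \<Rightarrow> real \<Rightarrow> (real \<Rightarrow> real) set" where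
  "holder_ball \<beta> L = {f. (\<forall>i < strict_floor \<beta>. (D01 ^^ i) f differentiable_on {0..1})
                       \<and> holder_norm \<beta> f \<le> ereal L}"

section \<open>Random design regression\<close>

definition std_normal :: "real measure" where
  "std_normal = density lborel (\<lambda>u. ennreal (std_normal_density u))"

text \<open>Law of one pair \<open>(X, f X + \<xi>)\<close>; the design law \<open>PX\<close> is a measure on \<open>[0,1]\<close>, i.e. its
  space is \<open>{0..1}\<close>.\<close>

definition pair_law :: "real measure \<Rightarrow> (real \<Rightarrow> real) \<Rightarrow> (real \<times> real) measure" where
  "pair_law PX f =
     distr (PX \<Otimes>\<^sub>M std_normal) (PX \<Otimes>\<^sub>M borel) (\<lambda>(x, \<xi>). (x, f x + \<xi>))"

definition sample_law ::
    "real measure \<Rightarrow> nat \<Rightarrow> (real \<Rightarrow> real) \<Rightarrow> (nat \<Rightarrow> real \<times> real) measure" where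
  "sample_law PX n f = PiM {..<n} (\<lambda>_. pair_law PX f)"

definition loglik :: "nat \<Rightarrow> (nat \<Rightarrow> real \<times> real) \<Rightarrow> (real \<Rightarrow> real) \<Rightarrow> real" where
  "loglik n Z f = - (1 / 2) * (\<Sum>i<n. (snd (Z i) - f (fst (Z i)))\<^sup>2)"

definition rho_posterior ::
    "(real \<Rightarrow> real) measure \<Rightarrow> real \<Rightarrow> nat \<Rightarrow> (nat \<Rightarrow> real \<times> real) \<Rightarrow> (real \<Rightarrow> real) set \<Rightarrow> real" where
  "rho_posterior P \<rho> n Z B =
     (LINT f:B|P. exp (\<rho> * loglik n Z f)) / (LINT f|P. exp (\<rho> * loglik n Z f))"

definition clip :: "real \<Rightarrow> (real \<Rightarrow> real) \<Rightarrow> real \<Rightarrow> real" where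
  "clip F f = (\<lambda>x. max (- F) (min (f x) F))"

definition clipped_rho_posterior ::
    "real \<Rightarrow> (real \<Rightarrow> real) measure \<Rightarrow> real \<Rightarrow> nat \<Rightarrow> (nat \<Rightarrow> real \<times> real) \<Rightarrow>
       (real \<Rightarrow> real) set \<Rightarrow> real" where
  "clipped_rho_posterior F P \<rho> n Z B = rho_posterior P \<rho> n Z (clip F -` B)"

text \<open>For \<open>P\<close> absolutely continuous with respect to \<open>Q\<close>; all laws \<open>sample_law PX n f\<close> with \<open>f\<close>
  measurable on \<open>[0,1]\<close> are mutually absolutely continuous.\<close>

definition renyi_div :: "real \<Rightarrow> 'a measure \<Rightarrow> 'a measure \<Rightarrow> real" where
  "renyi_div \<rho> P Q =
     1 / (\<rho> - 1) * ln (LINT z|Q. enn2real (RN_deriv Q P z) powr \<rho>)"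

definition L2_norm_wrt :: "real measure \<Rightarrow> (real \<Rightarrow> real) \<Rightarrow> real" where
  "L2_norm_wrt PX g = sqrt (LINT x|PX. (g x)\<^sup>2)"

section \<open>Shallow ReLU network priors\<close>

text \<open>\<open>2 ^ m\<close> where \<open>m\<close> is the integer closest to the solution \<open>m\<close> of
  \<open>2 ^ m = n powr (1 / (2 * s + 1))\<close>.\<close>

definition net_width :: "real \<Rightarrow> nat \<Rightarrow> nat" where
  "net_width s n = 2 ^ nat (round (log 2 (real n powr (1 / (2 * s + 1)))))"

definition shallow_net :: "nat \<Rightarrow> (nat \<Rightarrow> real) \<Rightarrow> real \<Rightarrow> real \<Rightarrow> real" where
  "shallow_net N w b x = (\<Sum>k<N. w k * max (x - real k / real N) 0) + b"

text \<open>Image of \<open>M\<close> under \<open>T\<close>, on the largest \<open>\<sigma>\<close>-algebra that makes \<open>T\<close> measurable.  In the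
  network prior this contains every set of functions whose set of parameters is measurable, in
  particular those defined through integrals of \<open>f\<close>, which need not lie in the product
  \<open>\<sigma>\<close>-algebra on \<open>real \<Rightarrow> real\<close>.\<close>

definition image_measure :: "'a measure \<Rightarrow> ('a \<Rightarrow> 'b) \<Rightarrow> 'b measure" where
  "image_measure M T = distr M (sigma UNIV {B. T -` B \<inter> space M \<in> sets M}) T"

text \<open>Here \<open>Z\<close> is the common law of the \<open>\<zeta>\<^sub>k\<close> and \<open>B\<close> the law of the bias \<open>b\<close>.\<close>

definition shallow_prior ::
    "real \<Rightarrow> nat \<Rightarrow> real \<Rightarrow> real measure \<Rightarrow> real measure \<Rightarrow> (real \<Rightarrow> real) measure" where
  "shallow_prior \<alpha> n \<sigma> Z B =
     image_measure (PiM {..<net_width \<alpha> n} (\<lambda>_. Z) \<Otimes>\<^sub>M B)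
       (\<lambda>(\<zeta>, b). shallow_net (net_width \<alpha> n) (\<lambda>k. \<sigma> * \<zeta> k) b)"

definition p_exp_density :: "real \<Rightarrow> real \<Rightarrow> real" where
  "p_exp_density p u =
     exp (- (\<bar>u\<bar> powr p) / p) / (LINT v|lborel. exp (- (\<bar>v\<bar> powr p) / p))"

definition p_exp_law :: "real \<Rightarrow> real measure" where
  "p_exp_law p = density lborel (\<lambda>u. ennreal (p_exp_density p u))"

end

theory Submission
  imports Defs "HOL-Real_Asymp.Real_Asymp"
begin

text \<open>The likelihood ratio \<open>r\<close> of \<open>f\<close> against \<open>f0\<close>, raised to the power \<open>\<rho>\<close>, has expectation
  \<open>exp (- (1 - \<rho>) D\<^sub>\<rho>)\<close> under \<open>f0\<close>, and its inverse has expectation at most \<open>exp (n \<eta>\<^sup>2)\<close> when \<open>f\<close> is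
  uniformly \<open>\<eta>\<close>-close to \<open>f0\<close>. The first bounds the numerator of the posterior probability of a set of
  functions with large divergence, the second (with the Cauchy-Schwarz inequality) the inverse of its
  denominator, so that contraction at rate \<open>\<epsilon>\<close> follows once the prior gives mass at least
  \<open>exp (- K n \<epsilon>\<^sup>2)\<close> to a uniform neighbourhood of \<open>f0\<close> of radius of order \<open>\<epsilon>\<close>. No tests and no
  entropy bounds are needed, because \<open>\<rho> < 1\<close>.

  For the prior mass, interpolate \<open>f0\<close> linearly at a dyadic subset of \<open>J\<close> knots, where \<open>J\<close> is of order
  \<open>n powr (1 / (1 + 2 \<beta>))\<close>, and keep each weight within \<open>n powr (-3/2)\<close> of its target. With \<open>p = 2 / ln n\<close>
  one has \<open>n powr p = exp 2\<close>, so that the prior density is at least a negative power of \<open>n\<close> on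
  polynomially large intervals; the \<open>J\<close> active weights therefore cost only a factor
  \<open>exp (- K J ln n)\<close>. All other weights must be small, which costs a constant factor: as \<open>t > 5/2\<close>, it
  suffices that \<open>\<bar>\<zeta>\<^sub>k\<bar> \<le> n\<close>, and this fails with probability at most \<open>n powr (-2)\<close> for each of the
  at most \<open>2 n\<close> weights.\<close>

section \<open>Expectation of a posterior probability\<close>

text \<open>If \<open>g \<circ> T\<close> is not measurable, both sides have the junk value \<open>0\<close>; hence the sets in the theorem
  need not be shown measurable.\<close>

lemma integral_image_measure:
  fixes g :: "'b \<Rightarrow> real"
  shows "(LINT f|image_measure M T. g f) = (LINT \<theta>|M. g (T \<theta>))"
proof -
  let ?C = "{B. T -` B \<inter> space M \<in> sets M}"
  let ?S = "sigma UNIV ?C"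
  have "sigma_algebra UNIV ?C"
    unfolding sigma_algebra_iff2
  proof (intro conjI ballI allI impI)
    fix s assume "s \<in> ?C"
    then have "space M - T -` s \<inter> space M \<in> sets M" by auto
    also have "space M - T -` s \<inter> space M = T -` (UNIV - s) \<inter> space M" by auto
    finally show "UNIV - s \<in> ?C" by simp
  next
    fix A :: "nat \<Rightarrow> 'b set" assume "range A \<subseteq> ?C"
    then have "(\<Union>i. T -` A i \<inter> space M) \<in> sets M" by (intro sets.countable_UN) auto
    also have "(\<Union>i. T -` A i \<inter> space M) = T -` (\<Union>i. A i) \<inter> space M" by auto
    finally show "(\<Union>i. A i) \<in> ?C" by simp
  qed auto
  then have sets_S: "sets ?S = ?C" by (simp add: sigma_algebra.sigma_sets_eq)
  have T: "T \<in> measurable M ?S"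
    by (rule measurable_measure_of) auto
  show ?thesis
  proof (cases "g \<in> borel_measurable ?S")
    case True
    then show ?thesis unfolding image_measure_def by (rule integral_distr[OF T])
  next
    case False
    have "(\<lambda>\<theta>. g (T \<theta>)) \<notin> borel_measurable M"
    proof
      assume *: "(\<lambda>\<theta>. g (T \<theta>)) \<in> borel_measurable M"
      have "g \<in> borel_measurable ?S"
      proof (rule measurableI)
        fix A :: "real set" assume "A \<in> sets borel"
        from measurable_sets[OF * this] show "g -` A \<inter> space ?S \<in> sets ?S"
          unfolding sets_S by (simp add: vimage_def)
      qed simp
      with False show False ..
    qed
    then have "\<not> integrable M (\<lambda>\<theta>. g (T \<theta>))" by auto
    moreover have "\<not> integrable (image_measure M T) g"
      using False borel_measurable_integrable[of "image_measure M T" g]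
      by (auto simp: image_measure_def)
    ultimately show ?thesis by (simp add: not_integrable_integral_eq)
  qed
qed

text \<open>Cauchy-Schwarz for \<open>sqrt (r \<theta>)\<close> and
  \<open>1 / sqrt (r \<theta>)\<close> on \<open>A\<close>. It bounds the inverse of the posterior
  normaliser by an expression linear in \<open>1 / r\<close>, which can then be averaged over the
  data by Fubini.\<close>

lemma ennreal_inverse_integral_le:
  fixes r :: "'a \<Rightarrow> real"
  assumes r: "integrable M r" and pos: "\<And>\<theta>. 0 < r \<theta>"
    and A: "A \<in> sets M" and a: "emeasure M A = ennreal a" "0 < a"
  shows "ennreal (1 / (LINT \<theta>|M. r \<theta>)) \<le> ennreal (1 / a\<^sup>2) * (\<integral>\<^sup>+\<theta>. indicator A \<theta> * ennreal (1 / r \<theta>) \<partial>M)"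
proof -
  note [measurable] = A borel_measurable_integrable[OF r]
  define D where "D = (LINT \<theta>|M. r \<theta>)"
  define I where "I = (\<integral>\<^sup>+\<theta>. indicator A \<theta> * ennreal (1 / r \<theta>) \<partial>M)"
  have D: "(\<integral>\<^sup>+\<theta>. ennreal (r \<theta>) \<partial>M) = ennreal D"
    unfolding D_def using r pos by (intro nn_integral_eq_integral) (auto intro: less_imp_le)
  have "D \<ge> 0" unfolding D_def using pos[THEN less_imp_le] by (intro integral_nonneg_AE) auto
  moreover have "D \<noteq> 0"
  proof
    assume "D = 0"
    then have "AE \<theta> in M. ennreal (r \<theta>) = 0"
      using D by (subst nn_integral_0_iff_AE[symmetric]) auto
    then have "AE \<theta> in M. False"
      by eventually_elim (metis ennreal_eq_0_iff not_le pos)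
    then have "emeasure M (space M) = 0"
      using AE_iff_measurable[of "space M" M "\<lambda>_. False"] by simp
    then have "emeasure M A = 0"
      using emeasure_mono[OF sets.sets_into_space[OF A], of M] by simp
    then show False using a by simp
  qed
  ultimately have Dpos: "0 < D" by simp
  \<comment> \<open>Cauchy-Schwarz, via \<open>2 s \<le> 1 / r + s\<^sup>2 r\<close> with the optimal \<open>s\<close>; this also covers an infinite
    right-hand side.\<close>
  define s where "s = a / D"
  have s: "0 < s" using a Dpos by (simp add: s_def)
  have pw: "ennreal (2 * s) * indicator A \<theta> \<le> indicator A \<theta> * ennreal (1 / r \<theta>) + ennreal (s\<^sup>2) * ennreal (r \<theta>)" for \<theta>
  proof (cases "\<theta> \<in> A")
    case True
    have "0 \<le> (1 - s * r \<theta>)\<^sup>2 / r \<theta>" using pos[of \<theta>] by simp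
    also have "\<dots> = 1 / r \<theta> + s\<^sup>2 * r \<theta> - 2 * s"
      using pos[of \<theta>] by (simp add: field_simps power2_eq_square)
    finally show ?thesis using True pos[of \<theta>] s
      by (simp add: ennreal_mult[symmetric] ennreal_plus[symmetric] del: ennreal_plus)
  qed simp
  have "ennreal (2 * s * a) = (\<integral>\<^sup>+\<theta>. ennreal (2 * s) * indicator A \<theta> \<partial>M)"
    using a s by (simp add: nn_integral_cmult_indicator ennreal_mult)
  also have "\<dots> \<le> (\<integral>\<^sup>+\<theta>. indicator A \<theta> * ennreal (1 / r \<theta>) + ennreal (s\<^sup>2) * ennreal (r \<theta>) \<partial>M)"
    by (intro nn_integral_mono pw)
  also have "\<dots> = I + ennreal (s\<^sup>2 * D)"
    by (subst nn_integral_add) (auto simp: I_def nn_integral_cmult D ennreal_mult Dpos less_imp_le)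
  finally have le: "ennreal (2 * s * a) \<le> I + ennreal (s\<^sup>2 * D)" .
  have eq: "2 * s * a = a\<^sup>2 / D + s\<^sup>2 * D"
    using Dpos by (simp add: s_def field_simps power2_eq_square)
  have "ennreal (a\<^sup>2 / D) \<le> I"
    using le Dpos unfolding eq by (subst (asm) ennreal_plus) (auto simp: add.commute[of I])
  then have "ennreal (1 / a\<^sup>2) * ennreal (a\<^sup>2 / D) \<le> ennreal (1 / a\<^sup>2) * I"
    by (rule mult_left_mono) simp
  moreover have "ennreal (1 / a\<^sup>2) * ennreal (a\<^sup>2 / D) = ennreal (1 / D)"
    using a Dpos by (simp add: ennreal_mult[symmetric])
  ultimately show ?thesis by (simp add: D_def I_def)
qed

text \<open>If \<open>g\<close> is not integrable, its Bochner integral is \<open>0\<close> by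
  convention and \<open>0 \<le> c\<close> gives the bound; otherwise the two integrals
  agree.\<close>

lemma integral_le_nn_integral_bound:
  fixes g :: "'a \<Rightarrow> real"
  assumes "\<And>z. z \<in> space Q \<Longrightarrow> 0 \<le> g z" "(\<integral>\<^sup>+z. ennreal (g z) \<partial>Q) \<le> ennreal c" "0 \<le> c"
  shows "(LINT z|Q. g z) \<le> c"
proof (cases "integrable Q g")
  case True
  then have "ennreal (LINT z|Q. g z) = (\<integral>\<^sup>+z. ennreal (g z) \<partial>Q)"
    using assms(1) by (intro nn_integral_eq_integral[symmetric]) auto
  then show ?thesis using assms(2,3) by (metis ennreal_le_iff)
qed (use assms in \<open>simp add: not_integrable_integral_eq\<close>)

text \<open>The two bounds are combined without splitting off a bad event: a posterior probability \<open>N / D\<close>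
  satisfies \<open>N \<le> D\<close>, hence \<open>N / D \<le> (\<lambda> N + 1 / (\<lambda> D)) / 2\<close>, and the two terms can be averaged over
  the data separately.\<close>

lemma expected_posterior_le:
  fixes r :: "'a \<Rightarrow> 'b \<Rightarrow> real"
  assumes M: "prob_space M" and Q: "prob_space Q"
    and r[measurable]: "(\<lambda>(\<theta>, z). r \<theta> z) \<in> borel_measurable (M \<Otimes>\<^sub>M Q)"
    and pos: "\<And>\<theta> z. 0 < r \<theta> z"
    and int: "\<And>z. z \<in> space Q \<Longrightarrow> integrable M (\<lambda>\<theta>. r \<theta> z)"
    and A[measurable]: "A \<in> sets M" and a: "a \<le> measure M A" "0 < a"
    and U: "\<And>\<theta>. \<theta> \<in> A \<Longrightarrow> (\<integral>\<^sup>+z. ennreal (1 / r \<theta> z) \<partial>Q) \<le> ennreal U" "0 \<le> U"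
    and V: "\<And>\<theta>. \<theta> \<in> space M \<Longrightarrow> \<theta> \<in> B \<Longrightarrow> (\<integral>\<^sup>+z. ennreal (r \<theta> z) \<partial>Q) \<le> ennreal V" "0 \<le> V"
    and lam: "0 < l"
  shows "(LINT z|Q. (LINT \<theta>|M. indicator B \<theta> * r \<theta> z) / (LINT \<theta>|M. r \<theta> z)) \<le> (l * V + U / (l * a)) / 2"
    and "0 \<le> (LINT z|Q. (LINT \<theta>|M. indicator B \<theta> * r \<theta> z) / (LINT \<theta>|M. r \<theta> z))"
proof -
  note [simp] = pos[THEN less_imp_le]
  interpret M: prob_space M by fact
  interpret Q: prob_space Q by fact
  interpret MQ: pair_sigma_finite M Q ..
  show "0 \<le> (LINT z|Q. (LINT \<theta>|M. indicator B \<theta> * r \<theta> z) / (LINT \<theta>|M. r \<theta> z))"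
    by (auto intro!: integral_nonneg_AE)
  have nonneg: "0 \<le> (l * V + U / (l * a)) / 2"
    using U V lam a by simp
  show "(LINT z|Q. (LINT \<theta>|M. indicator B \<theta> * r \<theta> z) / (LINT \<theta>|M. r \<theta> z)) \<le> (l * V + U / (l * a)) / 2"
  proof (cases "B \<inter> space M \<in> sets M")
    case False
    \<comment> \<open>For a non-measurable \<open>B\<close> the numerator is not integrable, because
      its integrand is positive exactly on \<open>B\<close>; its value is then \<open>0\<close> for
      every \<open>z\<close>.\<close>
    have "(LINT \<theta>|M. indicator B \<theta> * r \<theta> z) = 0" if z: "z \<in> space Q" for z
    proof (rule not_integrable_integral_eq, rule notI)
      assume "integrable M (\<lambda>\<theta>. indicator B \<theta> * r \<theta> z)"
      then have "(\<lambda>\<theta>. indicator B \<theta> * r \<theta> z) \<in> borel_measurable M" by simp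
      then have "(\<lambda>\<theta>. indicator B \<theta> * r \<theta> z) -` {0<..} \<inter> space M \<in> sets M"
        by (rule measurable_sets) simp
      also have "(\<lambda>\<theta>. indicator B \<theta> * r \<theta> z) -` {0<..} \<inter> space M = B \<inter> space M"
        using pos by (auto simp: indicator_def of_bool_def split: if_splits)
      finally show False using False by simp
    qed
    then have "(LINT z|Q. (LINT \<theta>|M. indicator B \<theta> * r \<theta> z) / (LINT \<theta>|M. r \<theta> z)) = (LINT z|Q. 0)"
      by (intro Bochner_Integration.integral_cong) auto
    then show ?thesis using nonneg by simp
  next
    case True
    note [measurable] = True
    \<comment> \<open>Cauchy-Schwarz uses the exact mass \<open>b\<close>: its factor
      \<open>1 / b\<^sup>2\<close> and the factor \<open>b\<close> from integrating \<open>I\<close>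
      leave \<open>1 / b\<close>, and only then is \<open>a \<le> b\<close> applied.\<close>
    define b where "b = (measure M A)"
    have b: "0 < b" "emeasure M A = ennreal b" "a \<le> b"
      using a by (auto simp: b_def M.emeasure_eq_measure)
    define N where "N z = (LINT \<theta>|M. indicator B \<theta> * r \<theta> z)" for z
    define D where "D z = (LINT \<theta>|M. r \<theta> z)" for z
    define N' where "N' z = (\<integral>\<^sup>+\<theta>. indicator (B \<inter> space M) \<theta> * ennreal (r \<theta> z) \<partial>M)" for z
    define I where "I z = (\<integral>\<^sup>+\<theta>. indicator A \<theta> * ennreal (1 / r \<theta> z) \<partial>M)" for z
    have [measurable]: "N' \<in> borel_measurable Q" "I \<in> borel_measurable Q"
      unfolding N'_def I_def by measurable
    have bound: "ennreal (N z / D z) \<le> ennreal (l / 2) * N' z + ennreal (1 / (2 * l * b\<^sup>2)) * I z"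
      if z: "z \<in> space Q" for z
    proof -
      have intN: "integrable M (\<lambda>\<theta>. indicator B \<theta> * r \<theta> z)"
        using integrable_mult_indicator[OF True int[OF z]]
        by (subst Bochner_Integration.integrable_cong[where g = "\<lambda>\<theta>. indicator (B \<inter> space M) \<theta> *\<^sub>R r \<theta> z"])
           (simp_all add: indicator_inter_arith)
      have N0: "0 \<le> N z" unfolding N_def
        by (auto intro!: integral_nonneg_AE)
      have ND: "N z \<le> D z" unfolding N_def D_def
        by (intro integral_mono intN int z) (auto simp: indicator_def pos less_imp_le)
      have N': "N' z = ennreal (N z)"
        unfolding N'_def N_def using intN
        by (subst nn_integral_eq_integral[symmetric])
           (auto intro!: nn_integral_cong simp: indicator_def)
      have I: "ennreal (1 / D z) \<le> ennreal (1 / b\<^sup>2) * I z"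
        unfolding D_def I_def by (rule ennreal_inverse_integral_le) (use int[OF z] pos b A in auto)
      have "N z / D z \<le> l / 2 * N z + 1 / (2 * l) * (1 / D z)"
      proof (cases "D z = 0")
        case False
        then have "0 < D z" using N0 ND by simp
        have "2 * (l * N z) \<le> (l * N z) * (l * N z) + 1"
          using sum_squares_bound[of "l * N z" 1] by (simp add: power2_eq_square)
        also have "\<dots> \<le> (l * N z) * (l * D z) + 1"
          using lam N0 ND by (intro add_right_mono mult_left_mono) auto
        finally show ?thesis using lam \<open>0 < D z\<close> by (simp add: field_simps)
      qed (use lam N0 in simp)
      then have "ennreal (N z / D z) \<le> ennreal (l / 2 * N z + 1 / (2 * l) * (1 / D z))"
        by (rule ennreal_leI)
      also have "\<dots> = ennreal (l / 2) * N' z + ennreal (1 / (2 * l)) * ennreal (1 / D z)"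
        using lam N0 ND by (simp add: N' ennreal_mult[symmetric] ennreal_plus[symmetric] del: ennreal_plus)
      also have "\<dots> \<le> ennreal (l / 2) * N' z + ennreal (1 / (2 * l)) * (ennreal (1 / b\<^sup>2) * I z)"
        by (intro add_left_mono mult_left_mono I) simp
      also have "ennreal (1 / (2 * l)) * (ennreal (1 / b\<^sup>2) * I z) = ennreal (1 / (2 * l * b\<^sup>2)) * I z"
        using lam by (simp add: mult.assoc[symmetric] ennreal_mult[symmetric])
      finally show ?thesis .
    qed
    have "(\<integral>\<^sup>+z. N' z \<partial>Q) = (\<integral>\<^sup>+\<theta>. (\<integral>\<^sup>+z. indicator (B \<inter> space M) \<theta> * ennreal (r \<theta> z) \<partial>Q) \<partial>M)"
      unfolding N'_def by (rule MQ.Fubini') measurable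
    also have "\<dots> \<le> (\<integral>\<^sup>+\<theta>. ennreal V \<partial>M)"
      by (intro nn_integral_mono) (auto simp: indicator_def intro!: V)
    also have "\<dots> = ennreal V" by (simp add: M.emeasure_space_1)
    finally have N': "(\<integral>\<^sup>+z. N' z \<partial>Q) \<le> ennreal V" .
    have "(\<integral>\<^sup>+z. I z \<partial>Q) = (\<integral>\<^sup>+\<theta>. (\<integral>\<^sup>+z. indicator A \<theta> * ennreal (1 / r \<theta> z) \<partial>Q) \<partial>M)"
      unfolding I_def by (rule MQ.Fubini') measurable
    also have "\<dots> \<le> (\<integral>\<^sup>+\<theta>. ennreal U * indicator A \<theta> \<partial>M)"
      by (intro nn_integral_mono) (auto simp: indicator_def intro!: U)
    also have "\<dots> = ennreal (U * b)" using U b by (simp add: nn_integral_cmult_indicator ennreal_mult)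
    finally have I: "(\<integral>\<^sup>+z. I z \<partial>Q) \<le> ennreal (U * b)" .
    have "(\<integral>\<^sup>+z. ennreal (N z / D z) \<partial>Q) \<le> (\<integral>\<^sup>+z. ennreal (l / 2) * N' z + ennreal (1 / (2 * l * b\<^sup>2)) * I z \<partial>Q)"
      by (intro nn_integral_mono bound)
    also have "\<dots> = ennreal (l / 2) * (\<integral>\<^sup>+z. N' z \<partial>Q) + ennreal (1 / (2 * l * b\<^sup>2)) * (\<integral>\<^sup>+z. I z \<partial>Q)"
      by (simp add: nn_integral_add nn_integral_cmult)
    also have "\<dots> \<le> ennreal (l / 2) * ennreal V + ennreal (1 / (2 * l * b\<^sup>2)) * ennreal (U * b)"
      by (intro add_mono mult_left_mono N' I) auto
    also have "\<dots> = ennreal (l / 2 * V + 1 / (2 * l * b\<^sup>2) * (U * b))"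
      using lam U V b by (simp add: ennreal_mult[symmetric] ennreal_plus[symmetric] del: ennreal_plus)
    also have "\<dots> \<le> ennreal ((l * V + U / (l * a)) / 2)"
    proof (rule ennreal_leI)
      have "1 / (2 * l * b\<^sup>2) * (U * b) = U / (2 * l * b)" using b lam
        by (simp add: field_simps power2_eq_square)
      also have "\<dots> \<le> U / (2 * l * a)"
        using U lam a b by (intro divide_left_mono mult_left_mono) auto
      finally show "l / 2 * V + 1 / (2 * l * b\<^sup>2) * (U * b) \<le> (l * V + U / (l * a)) / 2"
        by (simp add: add_divide_distrib mult.assoc)
    qed
    finally have "(\<integral>\<^sup>+z. ennreal (N z / D z) \<partial>Q) \<le> ennreal ((l * V + U / (l * a)) / 2)" .
    then have "(LINT z|Q. N z / D z) \<le> (l * V + U / (l * a)) / 2"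
      using nonneg
      by (intro integral_le_nn_integral_bound)
         (auto simp: N_def D_def intro!: divide_nonneg_nonneg integral_nonneg_AE)
    then show ?thesis by (simp add: N_def D_def)
  qed
qed

section \<open>Likelihood ratios in the Gaussian regression model\<close>

text \<open>The logarithm of the density of \<open>pair_law PX f\<close> with respect to
  \<open>pair_law PX g\<close>; the Gaussian normalising constants cancel.\<close>

definition pair_ratio :: "(real \<Rightarrow> real) \<Rightarrow> (real \<Rightarrow> real) \<Rightarrow> real \<times> real \<Rightarrow> real" where
  "pair_ratio f g p = ((snd p - g (fst p))\<^sup>2 - (snd p - f (fst p))\<^sup>2) / 2"

lemma loglik_diff: "loglik n Z f - loglik n Z g = (\<Sum>i<n. pair_ratio f g (Z i))"
  by (simp add: loglik_def pair_ratio_def sum_subtractf field_simps flip: sum_divide_distrib)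

text \<open>Completing the square in \<open>y\<close>: tilting a Gaussian by the power
  \<open>c\<close> of the likelihood ratio moves its mean along the line through \<open>g x\<close>
  and \<open>f x\<close> and leaves a constant. The powers used are \<open>\<rho>\<close>
  (numerator), \<open>- \<rho>\<close> (normaliser) and \<open>1\<close> (density).\<close>

lemma normal_density_ratio:
  "normal_density (g x) 1 y * exp (c * pair_ratio f g (x, y))
     = exp ((c\<^sup>2 - c) / 2 * (f x - g x)\<^sup>2) * normal_density (g x + c * (f x - g x)) 1 y"
proof -
  have "- (y - v)\<^sup>2 / 2 + c * (((y - v)\<^sup>2 - (y - u)\<^sup>2) / 2)
      = (c\<^sup>2 - c) / 2 * (u - v)\<^sup>2 + - (y - (v + c * (u - v)))\<^sup>2 / 2" for u v :: real
    by (simp add: power2_eq_square field_simps)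
  then show ?thesis
    unfolding normal_density_def pair_ratio_def by (simp add: exp_add[symmetric])
qed

section \<open>Change of measure for one observation and for the sample\<close>

locale design =
  fixes PX :: "real measure"
  assumes prob_space_design: "prob_space PX" and sets_design: "sets PX = sets (restrict_space borel {0..1})"
begin

sublocale prob_space PX by (rule prob_space_design)

lemma space_design: "space PX = {0..1}"
  using sets_eq_imp_space_eq[OF sets_design] by (simp add: space_restrict_space)

lemma sets_pair_law [measurable_cong]: "sets (pair_law PX f) = sets (PX \<Otimes>\<^sub>M borel)"
  by (simp add: pair_law_def)

text \<open>The substitution \<open>y = f x + u\<close> turns the additive noise into a Gaussian
  density centred at \<open>f x\<close>, so that all regression functions are compared over the same
  base measure.\<close>

lemma nn_integral_pair_law:
  assumes [measurable]: "f \<in> borel_measurable PX" "h \<in> borel_measurable (PX \<Otimes>\<^sub>M borel)"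
  shows "(\<integral>\<^sup>+p. h p \<partial>pair_law PX f) = (\<integral>\<^sup>+x. (\<integral>\<^sup>+y. ennreal (normal_density (f x) 1 y) * h (x, y) \<partial>lborel) \<partial>PX)"
proof -
  interpret S: prob_space std_normal
    unfolding std_normal_def by (rule prob_space_normal_density) simp
  have [measurable_cong]: "sets std_normal = sets borel" by (simp add: std_normal_def)
  have "(\<integral>\<^sup>+p. h p \<partial>pair_law PX f) = (\<integral>\<^sup>+x. (\<integral>\<^sup>+u. h (x, f x + u) \<partial>std_normal) \<partial>PX)"
    unfolding pair_law_def
    by (subst nn_integral_distr) (auto simp: S.nn_integral_fst[symmetric])
  also have "\<dots> = (\<integral>\<^sup>+x. (\<integral>\<^sup>+y. ennreal (normal_density (f x) 1 y) * h (x, y) \<partial>lborel) \<partial>PX)"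
  proof (rule nn_integral_cong)
    fix x assume [measurable]: "x \<in> space PX"
    show "(\<integral>\<^sup>+u. h (x, f x + u) \<partial>std_normal) = (\<integral>\<^sup>+y. ennreal (normal_density (f x) 1 y) * h (x, y) \<partial>lborel)"
      unfolding std_normal_def
      by (subst nn_integral_density, simp, simp,
          subst nn_integral_real_affine[where c = 1 and t = "f x"])
         (auto simp: normal_density_def)
  qed
  finally show ?thesis .
qed

lemma prob_space_pair_law:
  assumes [measurable]: "f \<in> borel_measurable PX"
  shows "prob_space (pair_law PX f)"
proof -
  interpret S: prob_space std_normal
    unfolding std_normal_def by (rule prob_space_normal_density) simp
  have [measurable_cong]: "sets std_normal = sets borel" by (simp add: std_normal_def)
  interpret P: pair_prob_space PX std_normal ..
  show ?thesis unfolding pair_law_def by (rule P.prob_space_distr) measurable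
qed

lemma measurable_pair_ratio [measurable]:
  assumes [measurable]: "f \<in> borel_measurable PX" "g \<in> borel_measurable PX"
  shows "pair_ratio f g \<in> borel_measurable (PX \<Otimes>\<^sub>M borel)"
  unfolding pair_ratio_def by measurable

lemma nn_integral_normal_density: "(\<integral>\<^sup>+y. ennreal (normal_density m 1 y) \<partial>lborel) = 1"
proof -
  interpret S: prob_space "density lborel (normal_density m 1)"
    by (rule prob_space_normal_density) simp
  show ?thesis using S.emeasure_space_1 by (simp add: emeasure_density)
qed

text \<open>After tilting, the inner integrand is a constant times a Gaussian density of total mass
  \<open>1\<close>; only the constant remains, averaged over the design.\<close>

lemma nn_integral_pair_ratio:
  assumes [measurable]: "f \<in> borel_measurable PX" "g \<in> borel_measurable PX"
  shows "(\<integral>\<^sup>+p. ennreal (exp (c * pair_ratio f g p)) \<partial>pair_law PX g)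
       = (\<integral>\<^sup>+x. ennreal (exp ((c\<^sup>2 - c) / 2 * (f x - g x)\<^sup>2)) \<partial>PX)"
proof -
  have "(\<integral>\<^sup>+p. ennreal (exp (c * pair_ratio f g p)) \<partial>pair_law PX g)
      = (\<integral>\<^sup>+x. (\<integral>\<^sup>+y. ennreal (normal_density (g x) 1 y) * ennreal (exp (c * pair_ratio f g (x, y))) \<partial>lborel) \<partial>PX)"
    by (rule nn_integral_pair_law) measurable
  also have "\<dots> = (\<integral>\<^sup>+x. (\<integral>\<^sup>+y. ennreal (exp ((c\<^sup>2 - c) / 2 * (f x - g x)\<^sup>2)) *
      ennreal (normal_density (g x + c * (f x - g x)) 1 y) \<partial>lborel) \<partial>PX)"
    by (simp only: ennreal_mult'[symmetric] normal_density_nonneg exp_ge_zero normal_density_ratio)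
  also have "\<dots> = (\<integral>\<^sup>+x. ennreal (exp ((c\<^sup>2 - c) / 2 * (f x - g x)\<^sup>2)) \<partial>PX)"
    by (subst nn_integral_cmult) (auto simp: nn_integral_normal_density)
  finally show ?thesis .
qed

lemma pair_law_eq_density:
  assumes [measurable]: "f \<in> borel_measurable PX" "g \<in> borel_measurable PX"
  shows "pair_law PX f = density (pair_law PX g) (\<lambda>p. ennreal (exp (pair_ratio f g p)))"
proof (rule measure_eqI)
  fix A assume "A \<in> sets (pair_law PX f)"
  then have [measurable]: "A \<in> sets (PX \<Otimes>\<^sub>M borel)" by (simp add: sets_pair_law)
  \<comment> \<open>For \<open>c = 1\<close> the exponent \<open>(c\<^sup>2 - c) / 2\<close>
    vanishes and the shifted mean is \<open>f x\<close>.\<close>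
  have eq: "normal_density (g x) 1 y * exp (pair_ratio f g (x, y)) = normal_density (f x) 1 y" for x y
    using normal_density_ratio[of g x y 1 f] by simp
  have "emeasure (pair_law PX f) A = (\<integral>\<^sup>+p. indicator A p \<partial>pair_law PX f)"
    by (simp add: nn_integral_indicator sets_pair_law)
  also have "\<dots> = (\<integral>\<^sup>+x. (\<integral>\<^sup>+y. ennreal (normal_density (f x) 1 y) * indicator A (x, y) \<partial>lborel) \<partial>PX)"
    by (rule nn_integral_pair_law) measurable
  also have "\<dots> = (\<integral>\<^sup>+x. (\<integral>\<^sup>+y. ennreal (normal_density (g x) 1 y) *
      (ennreal (exp (pair_ratio f g (x, y))) * indicator A (x, y)) \<partial>lborel) \<partial>PX)"
    by (simp only: mult.assoc[symmetric] ennreal_mult'[symmetric] normal_density_nonneg exp_ge_zero eq)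
  also have "\<dots> = (\<integral>\<^sup>+p. ennreal (exp (pair_ratio f g p)) * indicator A p \<partial>pair_law PX g)"
    by (rule nn_integral_pair_law[symmetric]) measurable
  finally show "emeasure (pair_law PX f) A = emeasure (density (pair_law PX g) (\<lambda>p. ennreal (exp (pair_ratio f g p)))) A"
    by (simp add: emeasure_density sets_pair_law)
qed (simp add: sets_pair_law)

lemma sets_sample_law [measurable_cong]: "sets (sample_law PX n f) = sets (PiM {..<n} (\<lambda>_. PX \<Otimes>\<^sub>M borel))"
  unfolding sample_law_def by (intro sets_PiM_cong) (auto simp: sets_pair_law)

lemma prob_space_sample_law:
  "f \<in> borel_measurable PX \<Longrightarrow> prob_space (sample_law PX n f)"
  unfolding sample_law_def by (intro prob_space_PiM prob_space_pair_law)

lemma nn_integral_sample_law_prod: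
  assumes f: "f \<in> borel_measurable PX" and h: "\<And>i. i < n \<Longrightarrow> h i \<in> borel_measurable (PX \<Otimes>\<^sub>M borel)"
  shows "(\<integral>\<^sup>+Z. (\<Prod>i<n. h i (Z i)) \<partial>sample_law PX n f) = (\<Prod>i<n. \<integral>\<^sup>+p. h i p \<partial>pair_law PX f)"
proof -
  interpret P: prob_space "pair_law PX f" by (rule prob_space_pair_law[OF f])
  interpret product_sigma_finite "\<lambda>_::nat. pair_law PX f" ..
  show ?thesis unfolding sample_law_def
    by (rule product_nn_integral_prod) (use h in \<open>auto simp: measurable_cong_sets[OF sets_pair_law refl]\<close>)
qed

lemma exp_sum_ennreal: "finite I \<Longrightarrow> ennreal (exp (\<Sum>i\<in>I. u i)) = (\<Prod>i\<in>I. ennreal (exp (u i :: real)))"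
  by (simp add: exp_sum prod_ennreal)

lemma nn_integral_loglik_diff:
  assumes [measurable]: "f \<in> borel_measurable PX" "g \<in> borel_measurable PX"
  shows "(\<integral>\<^sup>+Z. ennreal (exp (c * (loglik n Z f - loglik n Z g))) \<partial>sample_law PX n g)
       = (\<integral>\<^sup>+x. ennreal (exp ((c\<^sup>2 - c) / 2 * (f x - g x)\<^sup>2)) \<partial>PX) ^ n"
proof -
  have "(\<integral>\<^sup>+Z. ennreal (exp (c * (loglik n Z f - loglik n Z g))) \<partial>sample_law PX n g)
      = (\<integral>\<^sup>+Z. (\<Prod>i<n. ennreal (exp (c * pair_ratio f g (Z i)))) \<partial>sample_law PX n g)"
    by (simp only: loglik_diff sum_distrib_left exp_sum_ennreal finite_lessThan)
  also have "\<dots> = (\<Prod>i<n. \<integral>\<^sup>+p. ennreal (exp (c * pair_ratio f g p)) \<partial>pair_law PX g)"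
    by (rule nn_integral_sample_law_prod) measurable
  finally show ?thesis by (simp only: nn_integral_pair_ratio assms prod_constant card_lessThan)
qed

lemma measurable_loglik [measurable]:
  assumes [measurable]: "f \<in> borel_measurable PX"
  shows "(\<lambda>Z. loglik n Z f) \<in> borel_measurable (PiM {..<n} (\<lambda>_. PX \<Otimes>\<^sub>M borel))"
    and "(\<lambda>Z. loglik n Z f) \<in> borel_measurable (sample_law PX n g)"
  unfolding loglik_def by measurable

text \<open>A product measure is determined by rectangles, on which both the exponential of the sum
  and the indicator factorise. This identifies the Radon-Nikodym derivative inside
  \<open>renyi_div\<close> with the likelihood ratio.\<close>

lemma sample_law_eq_density:
  assumes [measurable]: "f \<in> borel_measurable PX" "g \<in> borel_measurable PX"
  shows "density (sample_law PX n g) (\<lambda>Z. ennreal (exp (loglik n Z f - loglik n Z g))) = sample_law PX n f"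
    (is "?D = _")
proof -
  interpret P: prob_space "pair_law PX f" by (rule prob_space_pair_law) fact
  interpret product_sigma_finite "\<lambda>_::nat. pair_law PX f" ..
  show ?thesis unfolding sample_law_def[of _ _ f]
  proof (rule PiM_eqI)
    show "sets ?D = sets (PiM {..<n} (\<lambda>_. pair_law PX f))"
      by (simp add: sets_sample_law sample_law_def[symmetric])
  next
    fix A :: "nat \<Rightarrow> (real \<times> real) set"
    assume A: "\<And>i. i \<in> {..<n} \<Longrightarrow> A i \<in> sets (pair_law PX f)"
    then have [measurable]: "i < n \<Longrightarrow> A i \<in> sets (PX \<Otimes>\<^sub>M borel)" for i by (simp add: sets_pair_law)
    have PA: "PiE {..<n} A \<in> sets (sample_law PX n g)"
      unfolding sets_sample_law by (intro sets_PiM_I_finite) auto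
    have "emeasure ?D (PiE {..<n} A) =
        (\<integral>\<^sup>+Z. (\<Prod>i<n. ennreal (exp (pair_ratio f g (Z i))) * indicator (A i) (Z i)) \<partial>sample_law PX n g)"
    proof (subst emeasure_density)
      show "(\<integral>\<^sup>+Z. ennreal (exp (loglik n Z f - loglik n Z g)) * indicator (PiE {..<n} A) Z \<partial>sample_law PX n g) =
        (\<integral>\<^sup>+Z. (\<Prod>i<n. ennreal (exp (pair_ratio f g (Z i))) * indicator (A i) (Z i)) \<partial>sample_law PX n g)"
      proof (rule nn_integral_cong)
        fix Z assume "Z \<in> space (sample_law PX n g)"
        \<comment> \<open>Membership in \<open>PiE\<close> also demands extensionality; the space of
          the product measure supplies it, so the indicator of the rectangle is a product.\<close>
        then have "Z \<in> extensional {..<n}" by (simp add: sample_law_def space_PiM PiE_def)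
        then have "indicator (PiE {..<n} A) Z = (\<Prod>i<n. indicator (A i) (Z i) :: ennreal)"
          by (cases "\<forall>i<n. Z i \<in> A i") (auto simp: indicator_def PiE_def Pi_def intro!: prod.neutral)
        then show "ennreal (exp (loglik n Z f - loglik n Z g)) * indicator (PiE {..<n} A) Z =
            (\<Prod>i<n. ennreal (exp (pair_ratio f g (Z i))) * indicator (A i) (Z i))"
          by (simp only: loglik_diff exp_sum_ennreal finite_lessThan prod.distrib)
      qed
    qed (simp_all add: PA)
    also have "\<dots> = (\<Prod>i<n. \<integral>\<^sup>+p. ennreal (exp (pair_ratio f g p)) * indicator (A i) p \<partial>pair_law PX g)"
      by (rule nn_integral_sample_law_prod) measurable
    also have "\<dots> = (\<Prod>i<n. emeasure (pair_law PX f) (A i))"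
      by (intro prod.cong refl)
         (simp add: pair_law_eq_density[of f g] emeasure_density sets_pair_law)
    finally show "emeasure ?D (PiE {..<n} A) = (\<Prod>i<n. emeasure (pair_law PX f) (A i))" .
  qed simp
qed

text \<open>The derivative \<open>RN_deriv\<close> is unique only almost everywhere, which suffices
  under the integral. Solving the definition of \<open>renyi_div\<close> for that integral requires
  it to be finite and positive.\<close>

lemma nn_integral_loglik_renyi:
  assumes [measurable]: "f \<in> borel_measurable PX" "g \<in> borel_measurable PX" and "0 < \<rho>" "\<rho> < 1"
  shows "(\<integral>\<^sup>+Z. ennreal (exp (\<rho> * (loglik n Z f - loglik n Z g))) \<partial>sample_law PX n g)
       = ennreal (exp (- (1 - \<rho>) * renyi_div \<rho> (sample_law PX n f) (sample_law PX n g)))"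
proof -
  interpret Q: prob_space "sample_law PX n g" by (rule prob_space_sample_law) fact
  let ?r = "\<lambda>Z. loglik n Z f - loglik n Z g"
  have "AE Z in sample_law PX n g. ennreal (exp (?r Z)) = RN_deriv (sample_law PX n g) (sample_law PX n f) Z"
    by (rule Q.RN_deriv_unique) (auto simp: sample_law_eq_density)
  then have "AE Z in sample_law PX n g. enn2real (RN_deriv (sample_law PX n g) (sample_law PX n f) Z) powr \<rho> = exp (\<rho> * ?r Z)"
  proof eventually_elim
    case (elim Z)
    show ?case unfolding elim[symmetric] by (simp add: powr_def)
  qed
  then have eq: "(LINT Z|sample_law PX n g. enn2real (RN_deriv (sample_law PX n g) (sample_law PX n f) Z) powr \<rho>)
      = (LINT Z|sample_law PX n g. exp (\<rho> * ?r Z))"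
    by (intro integral_cong_AE) auto
  define I where "I = (\<integral>\<^sup>+Z. ennreal (exp (\<rho> * ?r Z)) \<partial>sample_law PX n g)"
  \<comment> \<open>For \<open>0 < \<rho> < 1\<close> the exponent is nonpositive, so that
    \<open>I\<close> is at most \<open>1\<close>, hence finite.\<close>
  have "(\<integral>\<^sup>+x. ennreal (exp ((\<rho>\<^sup>2 - \<rho>) / 2 * (f x - g x)\<^sup>2)) \<partial>PX) \<le> (\<integral>\<^sup>+x. 1 \<partial>PX)"
  proof (intro nn_integral_mono)
    fix x
    have "(\<rho>\<^sup>2 - \<rho>) / 2 * (f x - g x)\<^sup>2 \<le> 0"
      using assms(3,4) by (intro mult_nonpos_nonneg) (auto simp: power2_eq_square mult_le_cancel_left1)
    then show "ennreal (exp ((\<rho>\<^sup>2 - \<rho>) / 2 * (f x - g x)\<^sup>2)) \<le> 1" by simp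
  qed
  then have "(\<integral>\<^sup>+x. ennreal (exp ((\<rho>\<^sup>2 - \<rho>) / 2 * (f x - g x)\<^sup>2)) \<partial>PX) \<le> 1"
    by (simp add: emeasure_space_1)
  then have "I \<le> 1"
    unfolding I_def nn_integral_loglik_diff[OF assms(1,2)] by (intro power_le_one) auto
  then have fin: "I < \<infinity>" by (simp add: order.strict_trans1 ennreal_one_less_top)
  then have int: "integrable (sample_law PX n g) (\<lambda>Z. exp (\<rho> * ?r Z))"
    unfolding I_def by (intro integrableI_nonneg) auto
  then have I: "I = ennreal (LINT Z|sample_law PX n g. exp (\<rho> * ?r Z))"
    unfolding I_def by (intro nn_integral_eq_integral) auto
  \<comment> \<open>Positivity is what lets \<open>exp\<close> undo the \<open>ln\<close> in
    \<open>renyi_div\<close>.\<close>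
  have "I \<noteq> 0"
  proof
    assume "I = 0"
    then have "AE Z in sample_law PX n g. ennreal (exp (\<rho> * ?r Z)) = 0"
      unfolding I_def by (subst (asm) nn_integral_0_iff_AE) auto
    then have "AE Z in sample_law PX n g. False"
      by eventually_elim (simp add: ennreal_eq_0_iff not_le)
    then show False by simp
  qed
  then have "0 < (LINT Z|sample_law PX n g. exp (\<rho> * ?r Z))"
    unfolding I by (simp add: ennreal_eq_0_iff not_le)
  then show ?thesis
    using assms(3,4) unfolding I_def[symmetric] I renyi_div_def eq
    by (simp add: minus_divide_right)
qed

end

section \<open>Piecewise linear interpolation of Hoelder functions\<close>

lemma strict_floor_le_2:
  assumes "0 < \<beta>" "\<beta> \<le> 2"
  shows "strict_floor \<beta> = (if \<beta> \<le> 1 then 0 else 1)"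
proof -
  have "\<lceil>\<beta>\<rceil> = (if \<beta> \<le> 1 then 1 else 2)"
    using assms by (auto simp: ceiling_eq_iff)
  then show ?thesis by (simp add: strict_floor_def)
qed

text \<open>The norm is a sum in \<open>ereal\<close>. Either summand is bounded by \<open>L\<close>
  because the other is nonnegative, and the maximum dominates its term with
  \<open>i = 0\<close>.\<close>

lemma holder_ball_bounds:
  assumes "f \<in> holder_ball \<beta> L"
  shows "x \<in> {0..1} \<Longrightarrow> \<bar>f x\<bar> \<le> L"
    and "x \<in> {0..1} \<Longrightarrow> y \<in> {0..1} \<Longrightarrow>
      \<bar>(D01 ^^ strict_floor \<beta>) f x - (D01 ^^ strict_floor \<beta>) f y\<bar> \<le> L * \<bar>x - y\<bar> powr (\<beta> - strict_floor \<beta>)"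
proof -
  define k where "k = strict_floor \<beta>"
  define S where "S i = (SUP x\<in>{0..1}. ereal \<bar>(D01 ^^ i) f x\<bar>)" for i
  define H where "H = (SUP (x, y)\<in>{(x, y). x \<in> {0..1} \<and> y \<in> {0..1} \<and> x \<noteq> y}.
          ereal (\<bar>(D01 ^^ k) f x - (D01 ^^ k) f y\<bar> / \<bar>x - y\<bar> powr (\<beta> - real k)))"
  have norm: "Max (S ` {0..k}) + H \<le> ereal L"
    using assms by (simp add: holder_ball_def holder_norm_def Let_def k_def S_def H_def)
  have "S 0 \<le> Max (S ` {0..k})" by (rule Max_ge) auto
  moreover have S_upper: "ereal \<bar>f x\<bar> \<le> S 0" if "x \<in> {0..1}" for x
    unfolding S_def using that by (intro SUP_upper2[where i = x]) auto
  moreover have H_upper: "ereal (\<bar>(D01 ^^ k) f x - (D01 ^^ k) f y\<bar> / \<bar>x - y\<bar> powr (\<beta> - real k)) \<le> H"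
    if "x \<in> {0..1}" "y \<in> {0..1}" "x \<noteq> y" for x y
    unfolding H_def by (rule SUP_upper2[where i = "(x, y)"]) (use that in auto)
  moreover have "0 \<le> H" by (rule order_trans[OF _ H_upper[of 0 1]]) auto
  moreover have "0 \<le> S 0" by (rule order_trans[OF _ S_upper[of 0]]) auto
  ultimately have MS: "S 0 \<le> Max (S ` {0..k})" and H0: "0 \<le> H" and S0: "0 \<le> S 0"
    by auto
  have Max0: "0 \<le> Max (S ` {0..k})" using S0 MS by (rule order_trans)
  show "\<bar>f x\<bar> \<le> L" if x: "x \<in> {0..1}"
  proof -
    have "ereal \<bar>f x\<bar> \<le> Max (S ` {0..k}) + H"
      using S_upper[OF x] MS H0 by (metis add.right_neutral add_mono order_trans)
    with norm show ?thesis by (metis ereal_less_eq(3) order_trans)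
  qed
  show "\<bar>(D01 ^^ strict_floor \<beta>) f x - (D01 ^^ strict_floor \<beta>) f y\<bar> \<le> L * \<bar>x - y\<bar> powr (\<beta> - strict_floor \<beta>)"
    if xy: "x \<in> {0..1}" "y \<in> {0..1}"
  proof (cases "x = y")
    case False
    have "H \<le> ereal L" using norm Max0 by (metis add.left_neutral add_right_mono order_trans)
    then have "\<bar>(D01 ^^ k) f x - (D01 ^^ k) f y\<bar> / \<bar>x - y\<bar> powr (\<beta> - real k) \<le> L"
      using H_upper[OF xy False] by (metis ereal_less_eq(3) order_trans)
    then show ?thesis using False by (simp add: k_def field_simps)
  qed simp
qed

lemma holder_continuous_on:
  fixes f :: "real \<Rightarrow> real"
  assumes "\<And>x y. x \<in> S \<Longrightarrow> y \<in> S \<Longrightarrow> \<bar>f x - f y\<bar> \<le> L * \<bar>x - y\<bar> powr \<beta>" "0 < \<beta>"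
  shows "continuous_on S f"
  unfolding continuous_on_def
proof
  fix x assume x: "x \<in> S"
  have lim: "((\<lambda>y. L * \<bar>y - x\<bar> powr \<beta>) \<longlongrightarrow> L * 0) (at x within S)"
  proof (intro tendsto_mult_left)
    show "((\<lambda>y. \<bar>y - x\<bar> powr \<beta>) \<longlongrightarrow> 0) (at x within S)"
      by (rule tendsto_zero_powrI[where b = \<beta>])
         (auto intro!: tendsto_eq_intros assms simp: eventually_at_filter)
  qed
  have "((\<lambda>y. f y - f x) \<longlongrightarrow> 0) (at x within S)"
  proof (rule Lim_null_comparison)
    show "\<forall>\<^sub>F y in at x within S. norm (f y - f x) \<le> L * \<bar>y - x\<bar> powr \<beta>"
      using assms(1)[OF _ x] by (auto simp: eventually_at_filter)
  qed (use lim in simp)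
  then show "(f \<longlongrightarrow> f x) (at x within S)" by (simp add: LIM_zero_iff)
qed

lemma holder_ball_continuous_on:
  assumes "f \<in> holder_ball \<beta> L" "0 < \<beta>" "\<beta> \<le> 2"
  shows "continuous_on {0..1} f"
proof (cases "\<beta> \<le> 1")
  case True
  then show ?thesis
    using holder_ball_bounds(2)[OF assms(1)] assms(2,3)
    by (intro holder_continuous_on[of _ _ L \<beta>]) (auto simp: strict_floor_le_2)
next
  case False
  then have "f differentiable_on {0..1}"
    using assms by (auto simp: holder_ball_def strict_floor_le_2)
  then show ?thesis by (rule differentiable_imp_continuous_on)
qed

text \<open>For \<open>\<beta> \<le> 1\<close>, the increment of \<open>f\<close> and that of the
  chord are each at most \<open>L * (b - a) powr \<beta>\<close>, whence the factor
  \<open>2\<close>. For \<open>\<beta> > 1\<close>, the mean value theorem on \<open>{a..x}\<close>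
  and on \<open>{a..b}\<close> writes the error as \<open>x - a\<close> times a difference of two
  derivative values, to which the Hoelder condition applies.\<close>

lemma holder_interpolation_error:
  assumes f: "f \<in> holder_ball \<beta> L" and \<beta>: "0 < \<beta>" "\<beta> \<le> 2" and L: "0 < L"
    and ab: "0 \<le> a" "a < b" "b \<le> 1" and x: "a \<le> x" "x \<le> b"
  shows "\<bar>f x - (f a + (f b - f a) / (b - a) * (x - a))\<bar> \<le> 2 * L * (b - a) powr \<beta>"
proof (cases "\<beta> \<le> 1")
  case True
  then have H: "\<bar>f u - f v\<bar> \<le> L * \<bar>u - v\<bar> powr \<beta>" if "u \<in> {0..1}" "v \<in> {0..1}" for u v
    using holder_ball_bounds(2)[OF f that] \<beta> by (simp add: strict_floor_le_2)
  have 1: "\<bar>f x - f a\<bar> \<le> L * (b - a) powr \<beta>"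
  proof -
    have "\<bar>f x - f a\<bar> \<le> L * \<bar>x - a\<bar> powr \<beta>" by (rule H) (use ab x in auto)
    also have "\<dots> \<le> L * (b - a) powr \<beta>" using L x \<beta> by (intro mult_left_mono powr_mono2) auto
    finally show ?thesis .
  qed
  define d where "d = (f b - f a) / (b - a) * (x - a)"
  have "\<bar>d\<bar> = \<bar>f b - f a\<bar> * ((x - a) / (b - a))"
    using ab x by (simp add: d_def abs_mult)
  also have "\<dots> \<le> \<bar>f b - f a\<bar> * 1" using ab x by (intro mult_left_mono) auto
  also have "\<dots> \<le> L * (b - a) powr \<beta>" using H[of b a] ab by simp
  finally show ?thesis using 1 unfolding d_def[symmetric] by linarith
next
  case False
  then have k: "strict_floor \<beta> = 1" using \<beta> by (simp add: strict_floor_le_2)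
  have D: "(f has_derivative (\<lambda>h. h * D01 f u)) (at u within {0..1})" if "u \<in> {0..1}" for u
  proof -
    have "f differentiable (at u within {0..1})"
      using f k that by (auto simp: holder_ball_def differentiable_on_def)
    then have "(f has_vector_derivative D01 f u) (at u within {0..1})"
      unfolding D01_def by (simp add: vector_derivative_works[symmetric])
    then show ?thesis by (simp add: has_vector_derivative_def)
  qed
  have mvt: "\<exists>u\<in>{v..w}. f w - f v = (w - v) * D01 f u" if "0 \<le> v" "v < w" "w \<le> 1" for v w
    using mvt_simple[of v w f "\<lambda>u h. h * D01 f u"] that
    by (force intro: has_derivative_subset[OF D])
  show ?thesis
  proof (cases "a = x")
    case False
    obtain u where u: "u \<in> {a..x}" "f x - f a = (x - a) * D01 f u"
      using mvt[of a x] ab x False by auto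
    obtain v where v: "v \<in> {a..b}" "f b - f a = (b - a) * D01 f v"
      using mvt[of a b] ab x by auto
    have "\<bar>D01 f u - D01 f v\<bar> \<le> L * \<bar>u - v\<bar> powr (\<beta> - 1)"
      using holder_ball_bounds(2)[OF f, of u v] k u v ab x by simp
    also have "\<dots> \<le> L * (b - a) powr (\<beta> - 1)"
      using L u v x \<open>\<not> \<beta> \<le> 1\<close> by (intro mult_left_mono powr_mono2) auto
    finally have D': "\<bar>D01 f u - D01 f v\<bar> \<le> L * (b - a) powr (\<beta> - 1)" .
    have "f x - (f a + (f b - f a) / (b - a) * (x - a)) = (x - a) * (D01 f u - D01 f v)"
    proof -
      have eq: "(f b - f a) / (b - a) = D01 f v" unfolding v(2) using ab by simp
      show ?thesis unfolding eq using u(2) by (simp add: algebra_simps)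
    qed
    then have "\<bar>f x - (f a + (f b - f a) / (b - a) * (x - a))\<bar> = (x - a) * \<bar>D01 f u - D01 f v\<bar>"
      using x by (simp add: abs_mult)
    also have "\<dots> \<le> (b - a) * (L * (b - a) powr (\<beta> - 1))"
      using x ab D' by (intro mult_mono) auto
    also have "\<dots> = L * (b - a) powr \<beta>"
      using ab by (simp add: powr_diff)
    also have "\<dots> \<le> 2 * L * (b - a) powr \<beta>" using L by simp
    finally show ?thesis .
  qed (use L in simp)
qed

text \<open>The coefficients are the changes of slope of the interpolant at its knots, with slope
  \<open>0\<close> before the first one. They telescope, so that the ramps up to knot
  \<open>i\<close> add up to the chord on the cell that starts there.\<close>

lemma linear_spline:
  fixes F :: "nat \<Rightarrow> real" and x h :: real
  assumes "h \<noteq> 0"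
  shows "(\<Sum>l\<le>i. ((F (Suc l) - F l) - (if l = 0 then 0 else F l - F (l - 1))) / h * (x - real l * h))
    = F i - F 0 + (F (Suc i) - F i) / h * (x - real i * h)"
proof (induction i)
  case (Suc i)
  show ?case unfolding sum.atMost_Suc Suc.IH using assms by (simp add: field_simps)
qed simp

section \<open>The heavy-tailed weight distribution\<close>

text \<open>The density \<open>p_exp_density p\<close> before normalisation.\<close>

definition pexp :: "real \<Rightarrow> real \<Rightarrow> real" where
  "pexp p u = exp (- (\<bar>u\<bar> powr p) / p)"

lemma measurable_pexp [measurable]: "pexp p \<in> borel_measurable borel"
  unfolding pexp_def by measurable

lemma pexp_pos: "0 < pexp p u" by (simp add: pexp_def)

lemma pexp_nonneg: "0 \<le> pexp p u" by (simp add: pexp_def)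

text \<open>The slope \<open>7\<close> turns into the tail exponent of the weight distribution; the bound holds as
  \<open>7 \<le> exp 2\<close>.\<close>

lemma exp_ge_linear_7: "7 * (x - 1) \<le> exp x" for x :: real
proof -
  have "25 / 18 \<le> exp (1 / 3 :: real)"
    using exp_lower_Taylor_quadratic[of "1 / 3 :: real"] by (simp add: power2_eq_square)
  then have "(25 / 18) ^ 6 \<le> exp (1 / 3 :: real) ^ 6" by (intro power_mono) auto
  moreover have "7 \<le> (25 / 18 :: real) ^ 6" by (simp add: power_divide)
  ultimately have "7 \<le> exp (2 :: real)" by (simp add: exp_of_nat_mult[symmetric] del: power_divide)
  then have "ln 7 \<le> (2 :: real)" using ln_le_cancel_iff[of 7 "exp 2 :: real"] by simp
  have "7 * (x - 1) \<le> 7 * (1 + (x - ln 7))" using \<open>ln 7 \<le> 2\<close> by simp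
  also have "\<dots> \<le> 7 * exp (x - ln 7)" by (intro mult_left_mono exp_ge_add_one_self) auto
  also have "\<dots> = exp x" by (simp add: exp_diff)
  finally show ?thesis .
qed

section \<open>Tails, lower bounds and normalisation of the weight density for
  \<open>p = 2 / ln x\<close>\<close>

context
  fixes x p :: real
  assumes x: "8 \<le> x" and p_def: "p = 2 / ln x"
begin

lemma p_pos: "0 < p" using x by (simp add: p_def)

text \<open>With \<open>y = p * ln u\<close> one has
  \<open>u powr p = exp y \<ge> 7 * (y - 1)\<close>. Division by \<open>p\<close> leaves
  \<open>7 * ln u - 7 / p\<close>, where \<open>7 / p = 7 / 2 * ln x\<close> becomes the factor
  \<open>x powr (7 / 2)\<close>.\<close>

lemma pexp_tail:
  assumes "0 < u"
  shows "pexp p u \<le> x powr (7 / 2) * inverse u ^ 7"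
proof -
  have "7 * (p * ln u - 1) \<le> u powr p"
    using exp_ge_linear_7[of "p * ln u"] assms by (simp add: powr_def mult.commute)
  then have "7 * (p * ln u - 1) / p \<le> u powr p / p"
    using p_pos by (intro divide_right_mono) auto
  then have "- (u powr p) / p \<le> 7 / 2 * ln x - 7 * ln u"
  proof -
    have "7 * (p * ln u - 1) / p = 7 * ln u - 7 / p" using p_pos by (simp add: field_simps)
    moreover have "7 / p = 7 / 2 * ln x" by (simp add: p_def)
    ultimately show ?thesis using \<open>7 * (p * ln u - 1) / p \<le> u powr p / p\<close> by simp
  qed
  then have "pexp p u \<le> exp (7 / 2 * ln x - 7 * ln u)"
    using assms by (simp add: pexp_def)
  also have "\<dots> = x powr (7 / 2) / u powr 7"
    using assms x by (simp add: exp_diff powr_def)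
  finally show ?thesis using assms by (simp only: powr_numeral divide_inverse power_inverse)
qed

text \<open>As \<open>(x powr s) powr p = exp (2 * s)\<close> and \<open>1 / p = ln x / 2\<close>,
  the density at a polynomially large point is only polynomially small. This keeps large weights
  cheap.\<close>

lemma pexp_lower:
  assumes "\<bar>u\<bar> \<le> x powr s"
  shows "x powr (- exp (2 * s) / 2) \<le> pexp p u"
proof -
  have "\<bar>u\<bar> powr p \<le> (x powr s) powr p"
    using assms p_pos by (intro powr_mono2) auto
  also have "\<dots> = exp (2 * s)" using x by (simp add: powr_powr p_def powr_def)
  finally have "- exp (2 * s) / p \<le> - (\<bar>u\<bar> powr p) / p"
    using p_pos by (simp add: divide_right_mono)
  moreover have "- exp (2 * s) / p = - exp (2 * s) / 2 * ln x"
    by (simp add: p_def)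
  then have "x powr (- exp (2 * s) / 2) = exp (- exp (2 * s) / p)"
    using x by (simp add: powr_def)
  ultimately show ?thesis by (simp only: pexp_def exp_le_cancel_iff)
qed

text \<open>Each of the two tails contributes at most the integral of the bound in
  \<open>pexp_tail\<close> beyond \<open>x\<close>, which is
  \<open>x powr (7 / 2) * x powr (- 6) / 6\<close>.\<close>

lemma nn_integral_pexp_tail:
  "(\<integral>\<^sup>+u. ennreal (pexp p u) * indicator {u. x < \<bar>u\<bar>} u \<partial>lborel) \<le> ennreal (x powr (- 5 / 2) / 3)"
proof -
  let ?t = "\<lambda>u. ennreal (x powr (7 / 2) * inverse u ^ 7) * indicator {x..} u"
  have "(\<integral>\<^sup>+u. ?t u \<partial>lborel) = ennreal (0 - (- (x powr (7 / 2)) / 6 * inverse x ^ 6))"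
  proof (rule nn_integral_FTC_atLeast[where F = "\<lambda>u. - (x powr (7 / 2)) / 6 * inverse u ^ 6" and T = 0])
    fix u assume u: "x \<le> u"
    show "((\<lambda>u. - (x powr (7 / 2)) / 6 * inverse u ^ 6) has_real_derivative x powr (7 / 2) * inverse u ^ 7) (at u)"
      by (rule DERIV_cong[OF DERIV_cmult[OF DERIV_power[OF DERIV_inverse]]])
         (use u x in \<open>auto simp: eval_nat_numeral\<close>)
    show "0 \<le> x powr (7 / 2) * inverse u ^ 7" using u x by simp
  next
    show "((\<lambda>u. - (x powr (7 / 2)) / 6 * inverse u ^ 6) \<longlongrightarrow> 0) at_top"
      by real_asymp
  qed measurable
  also have "0 - (- (x powr (7 / 2)) / 6 * inverse x ^ 6) = x powr (- 5 / 2) / 6"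
  proof -
    have "x powr (7 / 2) = x powr (- 5 / 2 + 6)" by simp
    also have "\<dots> = x powr (- 5 / 2) * x ^ 6" using x unfolding powr_add by simp
    finally show ?thesis using x by (simp add: field_simps)
  qed
  finally have t: "(\<integral>\<^sup>+u. ?t u \<partial>lborel) = ennreal (x powr (- 5 / 2) / 6)" .
  have "(\<integral>\<^sup>+u. ?t u \<partial>lborel) = (\<integral>\<^sup>+u. ?t (- u) \<partial>lborel)"
    by (subst nn_integral_real_affine[where c = "-1" and t = 0]) auto
  then have t': "(\<integral>\<^sup>+u. ?t (- u) \<partial>lborel) = ennreal (x powr (- 5 / 2) / 6)" by (rule trans[OF sym t])
  have "(\<integral>\<^sup>+u. ennreal (pexp p u) * indicator {u. x < \<bar>u\<bar>} u \<partial>lborel) \<le> (\<integral>\<^sup>+u. ?t u + ?t (- u) \<partial>lborel)"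
  proof (intro nn_integral_mono)
    fix u
    show "ennreal (pexp p u) * indicator {u. x < \<bar>u\<bar>} u \<le> ?t u + ?t (- u)"
    proof (cases "x < \<bar>u\<bar>")
      case True
      have "pexp p u = pexp p \<bar>u\<bar>" by (simp add: pexp_def)
      also have "\<dots> \<le> x powr (7 / 2) * inverse \<bar>u\<bar> ^ 7" using True x by (intro pexp_tail) auto
      finally have "ennreal (pexp p u) \<le> ennreal (x powr (7 / 2) * inverse \<bar>u\<bar> ^ 7)" by (rule ennreal_leI)
      then show ?thesis using True x by (cases "0 \<le> u") (auto simp: indicator_def)
    qed simp
  qed
  also have "\<dots> = (\<integral>\<^sup>+u. ?t u \<partial>lborel) + (\<integral>\<^sup>+u. ?t (- u) \<partial>lborel)"
    by (rule nn_integral_add) measurable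
  also have "\<dots> = ennreal (x powr (- 5 / 2) / 6) + ennreal (x powr (- 5 / 2) / 6)"
    by (simp only: t t')
  also have "\<dots> = ennreal (x powr (- 5 / 2) / 3)"
    by (subst ennreal_plus[symmetric]) auto
  finally show ?thesis .
qed

definition pexp_mass :: real where "pexp_mass = (LINT u|lborel. pexp p u)"

text \<open>Upper bound: the density is at most \<open>1\<close> on \<open>{-x..x}\<close> and the
  tails are small. Lower bound: \<open>pexp_lower\<close> with \<open>s = 0\<close> on
  \<open>{-1..1}\<close>.\<close>

lemma pexp_mass:
  "(\<integral>\<^sup>+u. ennreal (pexp p u) \<partial>lborel) = ennreal pexp_mass" (is ?int)
  "2 * x powr (- 1 / 2) \<le> pexp_mass" (is ?lower)
  "pexp_mass \<le> 4 * x" (is ?upper)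
proof -
  have le1: "pexp p u \<le> 1" for u using p_pos by (simp add: pexp_def)
  have "(\<integral>\<^sup>+u. ennreal (pexp p u) \<partial>lborel)
      = (\<integral>\<^sup>+u. ennreal (pexp p u) * indicator {-x..x} u + ennreal (pexp p u) * indicator {u. x < \<bar>u\<bar>} u \<partial>lborel)"
    by (intro nn_integral_cong) (auto simp: indicator_def)
  also have "\<dots> = (\<integral>\<^sup>+u. ennreal (pexp p u) * indicator {-x..x} u \<partial>lborel)
      + (\<integral>\<^sup>+u. ennreal (pexp p u) * indicator {u. x < \<bar>u\<bar>} u \<partial>lborel)"
    by (rule nn_integral_add) auto
  also have "\<dots> \<le> (\<integral>\<^sup>+u. 1 * indicator {-x..x} u \<partial>lborel) + ennreal (x powr (- 5 / 2) / 3)"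
    using le1 by (intro add_mono nn_integral_pexp_tail nn_integral_mono mult_right_mono) auto
  also have "\<dots> = ennreal (2 * x + x powr (- 5 / 2) / 3)"
    using x by (simp add: ennreal_plus[symmetric] del: ennreal_plus)
  also have "\<dots> \<le> ennreal (4 * x)"
  proof (rule ennreal_leI)
    have "x powr (- 5 / 2) \<le> x powr 0" using x by (intro powr_mono) auto
    then show "2 * x + x powr (- 5 / 2) / 3 \<le> 4 * x" using x by simp
  qed
  finally have le: "(\<integral>\<^sup>+u. ennreal (pexp p u) \<partial>lborel) \<le> ennreal (4 * x)" .
  have "integrable lborel (pexp p)"
    using order_le_less_trans[OF le ennreal_less_top]
    by (intro integrableI_nonneg) (auto simp: pexp_nonneg)
  then show int: ?int unfolding pexp_mass_def
    by (intro nn_integral_eq_integral) (auto simp: pexp_nonneg)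
  show ?upper using le x unfolding int by (simp add: ennreal_le_iff)
  have "ennreal (x powr (- 1 / 2) * 2) = (\<integral>\<^sup>+u. ennreal (x powr (- 1 / 2)) * indicator {-1..1::real} u \<partial>lborel)"
    by (subst nn_integral_cmult_indicator) (auto simp: ennreal_mult')
  also have "\<dots> \<le> (\<integral>\<^sup>+u. ennreal (pexp p u) \<partial>lborel)"
  proof (intro nn_integral_mono)
    fix u
    show "ennreal (x powr (- 1 / 2)) * indicator {-1..1} u \<le> ennreal (pexp p u)"
      using pexp_lower[of u 0] x by (auto simp: indicator_def intro!: ennreal_leI)
  qed
  finally show ?lower unfolding int
  proof -
    assume "ennreal (x powr (- 1 / 2) * 2) \<le> ennreal pexp_mass"
    moreover have "0 < x powr (- 1 / 2) * 2" using x by simp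
    ultimately show "2 * x powr (- 1 / 2) \<le> pexp_mass"
      by (simp only: ennreal_le_iff2 mult.commute[of 2]) linarith
  qed
qed

lemma pexp_mass_pos: "0 < pexp_mass"
proof -
  have "0 < 2 * x powr (- 1 / 2)" using x by simp
  then show ?thesis using pexp_mass(2) by (rule order.strict_trans2)
qed

lemma p_exp_law_eq: "p_exp_law p = density lborel (\<lambda>u. ennreal (pexp p u / pexp_mass))"
  by (simp add: p_exp_law_def p_exp_density_def pexp_mass_def pexp_def)

lemma emeasure_p_exp_law:
  assumes [measurable]: "A \<in> sets borel"
  shows "emeasure (p_exp_law p) A = ennreal (1 / pexp_mass) * (\<integral>\<^sup>+u. ennreal (pexp p u) * indicator A u \<partial>lborel)"
proof -
  have eq: "ennreal (pexp p u / pexp_mass) = ennreal (1 / pexp_mass) * ennreal (pexp p u)" for u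
    using pexp_mass_pos pexp_pos[of p u] by (simp add: ennreal_mult[symmetric])
  show ?thesis unfolding p_exp_law_eq eq
    by (subst emeasure_density) (auto simp: mult.assoc nn_integral_cmult)
qed

lemma prob_space_p_exp_law: "prob_space (p_exp_law p)"
proof
  have "emeasure (p_exp_law p) UNIV = ennreal (1 / pexp_mass) * ennreal pexp_mass"
    by (subst emeasure_p_exp_law) (auto simp: pexp_mass)
  also have "\<dots> = 1" using pexp_mass_pos by (simp add: ennreal_mult[symmetric])
  finally show "emeasure (p_exp_law p) (space (p_exp_law p)) = 1" by (simp add: p_exp_law_eq)
qed

text \<open>The tail integral of order \<open>x powr (- 5 / 2)\<close>, divided by a mass of order
  at least \<open>x powr (- 1 / 2)\<close>, leaves order \<open>x powr (- 2)\<close>. With at most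
  \<open>2 * x\<close> independent weights, all of them stay in the interval with probability
  bounded below.\<close>

lemma p_exp_law_tail: "1 - 1 / x\<^sup>2 \<le> measure (p_exp_law p) {-x..x}"
proof -
  interpret prob_space "p_exp_law p" by (rule prob_space_p_exp_law)
  have [simp]: "space (p_exp_law p) = UNIV" "sets (p_exp_law p) = sets borel" by (auto simp: p_exp_law_eq)
  have "emeasure (p_exp_law p) {u. x < \<bar>u\<bar>} \<le> ennreal (1 / pexp_mass) * ennreal (x powr (- 5 / 2) / 3)"
    by (subst emeasure_p_exp_law) (simp, intro mult_left_mono nn_integral_pexp_tail, simp)
  also have "\<dots> = ennreal (x powr (- 5 / 2) / 3 / pexp_mass)"
    using pexp_mass_pos by (simp add: ennreal_mult[symmetric])
  finally have "prob {u. x < \<bar>u\<bar>} \<le> x powr (- 5 / 2) / 3 / pexp_mass"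
    using pexp_mass_pos by (simp add: emeasure_eq_measure)
  also have "\<dots> \<le> x powr (- 5 / 2) / 3 / (2 * x powr (- 1 / 2))"
    using pexp_mass pexp_mass_pos x by (intro divide_left_mono) auto
  also have "\<dots> = x powr (- 5 / 2 - (- 1 / 2)) / 6"
    unfolding powr_diff by simp
  also have "\<dots> = x powr (- 2) / 6" by simp
  also have "\<dots> \<le> 1 / x\<^sup>2" using x by (simp add: powr_minus_divide field_simps)
  finally have "prob {u. x < \<bar>u\<bar>} \<le> 1 / x\<^sup>2" .
  moreover have "{-x..x} = space (p_exp_law p) - {u. x < \<bar>u\<bar>}" by auto
  then have "prob {-x..x} = 1 - prob {u. x < \<bar>u\<bar>}"
    by (simp only:) (subst prob_compl, auto)
  ultimately show ?thesis by simp
qed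

lemma p_exp_law_interval:
  assumes "a \<le> b" "\<bar>a\<bar> \<le> x powr s" "\<bar>b\<bar> \<le> x powr s"
  shows "(b - a) * (x powr (- exp (2 * s) / 2) / (4 * x)) \<le> measure (p_exp_law p) {a..b}"
proof -
  interpret prob_space "p_exp_law p" by (rule prob_space_p_exp_law)
  let ?c = "x powr (- exp (2 * s) / 2)"
  have "ennreal (?c * (b - a)) = (\<integral>\<^sup>+u. ennreal ?c * indicator {a..b} u \<partial>lborel)"
    using assms by (simp add: nn_integral_cmult_indicator ennreal_mult')
  also have "\<dots> \<le> (\<integral>\<^sup>+u. ennreal (pexp p u) * indicator {a..b} u \<partial>lborel)"
  proof (intro nn_integral_mono)
    fix u
    have "\<bar>u\<bar> \<le> x powr s" if "u \<in> {a..b}" using that assms by auto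
    then show "ennreal ?c * indicator {a..b} u \<le> ennreal (pexp p u) * indicator {a..b} u"
      using pexp_lower[of u s] by (auto simp: indicator_def intro: ennreal_leI)
  qed
  finally have "ennreal (1 / pexp_mass) * ennreal (?c * (b - a)) \<le> emeasure (p_exp_law p) {a..b}"
    by (subst emeasure_p_exp_law) (auto intro!: mult_left_mono)
  then have "1 / pexp_mass * (?c * (b - a)) \<le> prob {a..b}"
    using pexp_mass_pos by (simp add: emeasure_eq_measure ennreal_mult'[symmetric])
  moreover have "1 / (4 * x) * (?c * (b - a)) \<le> 1 / pexp_mass * (?c * (b - a))"
    using pexp_mass(3) pexp_mass_pos assms(1) x
    by (intro mult_right_mono divide_left_mono) auto
  ultimately show ?thesis by (simp add: mult.commute)
qed

end

section \<open>Prior mass around the true regression function\<close>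

text \<open>The target weights \<open>v\<close> sit at the multiples of \<open>q\<close>, whose
  knots are the grid points \<open>l / J\<close>, and are the slope changes of the interpolant of
  \<open>f\<close> there. On \<open>[0,1]\<close> every ramp is at most \<open>1\<close>, so the
  errors of the weights add up to at most \<open>J * q * \<delta>\<close>.\<close>

lemma shallow_net_approx:
  assumes f: "f \<in> holder_ball \<beta> L" and \<beta>: "0 < \<beta>" "\<beta> \<le> 2" and L: "0 < L"
    and J: "0 < J" and q: "0 < q"
  obtains v where "\<And>k. k < J * q \<Longrightarrow> \<bar>v k\<bar> \<le> 4 * L * real J" "\<And>k. \<not> q dvd k \<Longrightarrow> v k = 0"
    "\<And>w b \<delta> e x. (\<And>k. k < J * q \<Longrightarrow> \<bar>w k - v k\<bar> \<le> \<delta>) \<Longrightarrow> \<bar>b - f 0\<bar> \<le> e \<Longrightarrow> x \<in> {0..1} \<Longrightarrow>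
       \<bar>shallow_net (J * q) w b x - f x\<bar> \<le> real (J * q) * \<delta> + e + 2 * L * (1 / real J) powr \<beta>"
proof -
  define h where "h = 1 / real J"
  have h: "0 < h" using J by (simp add: h_def)
  define F where "F l = f (real l * h)" for l
  define \<Delta> where "\<Delta> l = ((F (Suc l) - F l) - (if l = 0 then 0 else F l - F (l - 1))) / h" for l
  define v where "v k = (if q dvd k then \<Delta> (k div q) else 0)" for k
  have grid: "real l * h \<in> {0..1}" if "l \<le> J" for l
    using that J by (simp add: h_def)
  have F_bound: "\<bar>F l\<bar> \<le> L" if "l \<le> J" for l
    unfolding F_def using holder_ball_bounds(1)[OF f grid[OF that]] .
  have v_bound: "\<bar>v k\<bar> \<le> 4 * L * real J" if k: "k < J * q" for k
  proof -
    have l: "k div q < J" using k q by (simp add: less_mult_imp_div_less)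
    \<comment> \<open>A second difference has coefficients of total size \<open>4\<close>. For
      \<open>k div q = 0\<close> the index \<open>k div q - 1\<close> is \<open>0\<close> on the
      naturals, so \<open>F_bound\<close> covers all three values.\<close>
    have "\<bar>(c1 - c2) - (if P then 0 else c2 - c3)\<bar> \<le> 4 * L"
      if "\<bar>c1\<bar> \<le> L" "\<bar>c2\<bar> \<le> L" "\<bar>c3\<bar> \<le> L" for c1 c2 c3 :: real and P
      using that by (cases P; simp; linarith)
    note tri = this
    have "\<bar>(F (Suc (k div q)) - F (k div q)) - (if k div q = 0 then 0 else F (k div q) - F (k div q - 1))\<bar> \<le> 4 * L"
      by (rule tri; rule F_bound) (use l in auto)
    then have "\<bar>\<Delta> (k div q)\<bar> \<le> 4 * L * real J"
      using J by (simp add: \<Delta>_def h_def abs_mult mult_right_mono)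
    then show ?thesis using L by (simp add: v_def)
  qed
  have spline: "\<bar>(\<Sum>k<J * q. v k * max (x - real k / real (J * q)) 0) + f 0 - f x\<bar> \<le> 2 * L * (1 / real J) powr \<beta>"
    if x: "x \<in> {0..1}" for x
  proof -
    \<comment> \<open>The minimum with \<open>J - 1\<close> puts the endpoint \<open>x = 1\<close>
      into the last cell rather than beyond the grid.\<close>
    define i where "i = min (J - 1) (nat \<lfloor>x * real J\<rfloor>)"
    have iJ: "i < J" using J by (simp add: i_def)
    have "real (nat \<lfloor>x * real J\<rfloor>) \<le> x * real J" using x J by simp
    then have "real i \<le> x * real J" unfolding i_def by linarith
    then have xi: "real i * h \<le> x" using J by (simp add: h_def field_simps)
    have "x * real J \<le> real (Suc i)"
    proof (cases "nat \<lfloor>x * real J\<rfloor> \<le> J - 1")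
      case True
      then have "i = nat \<lfloor>x * real J\<rfloor>" by (simp add: i_def)
      moreover have "x * real J \<ge> 0" using x by simp
      ultimately show ?thesis by linarith
    next
      case False
      then have "i = J - 1" by (simp add: i_def)
      then show ?thesis using x J by (simp add: mult_left_le_one_le of_nat_diff)
    qed
    then have xSi: "x \<le> real (Suc i) * h" using J by (simp add: h_def field_simps)
    have "(\<Sum>k<J * q. v k * max (x - real k / real (J * q)) 0)
        = (\<Sum>k\<in>(\<lambda>l. l * q) ` {..<J}. v k * max (x - real k / real (J * q)) 0)"
    proof (rule sum.mono_neutral_right)
      show "(\<lambda>l. l * q) ` {..<J} \<subseteq> {..<J * q}" using q by auto
      show "\<forall>k\<in>{..<J * q} - (\<lambda>l. l * q) ` {..<J}. v k * max (x - real k / real (J * q)) 0 = 0"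
      proof
        fix k assume k: "k \<in> {..<J * q} - (\<lambda>l. l * q) ` {..<J}"
        have "\<not> q dvd k"
        proof
          assume "q dvd k"
          then obtain l where "k = l * q" by (metis dvd_div_mult_self)
          with k q show False by auto
        qed
        then show "v k * max (x - real k / real (J * q)) 0 = 0" by (simp add: v_def)
      qed
    qed simp
    also have "\<dots> = (\<Sum>l<J. \<Delta> l * max (x - real l * h) 0)"
      using q by (subst sum.reindex) (auto simp: inj_on_def v_def h_def)
    also have "\<dots> = (\<Sum>l\<le>i. \<Delta> l * max (x - real l * h) 0)"
    proof (rule sum.mono_neutral_right)
      show "\<forall>l\<in>{..<J} - {..i}. \<Delta> l * max (x - real l * h) 0 = 0"
      proof
        fix l assume "l \<in> {..<J} - {..i}"
        then have "real (Suc i) * h \<le> real l * h" using h by (intro mult_right_mono) auto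
        then show "\<Delta> l * max (x - real l * h) 0 = 0" using xSi by simp
      qed
    qed (use iJ in auto)
    also have "\<dots> = (\<Sum>l\<le>i. \<Delta> l * (x - real l * h))"
    proof (rule sum.cong[OF refl])
      fix l assume "l \<in> {..i}"
      then have "real l * h \<le> real i * h" using h by (intro mult_right_mono) auto
      then show "\<Delta> l * max (x - real l * h) 0 = \<Delta> l * (x - real l * h)" using xi by simp
    qed
    also have "\<dots> = F i - F 0 + (F (Suc i) - F i) / h * (x - real i * h)"
      unfolding \<Delta>_def using h by (intro linear_spline) simp
    finally have eq: "(\<Sum>k<J * q. v k * max (x - real k / real (J * q)) 0) = \<dots>" .
    have "\<bar>f x - (f (real i * h) + (f (real (Suc i) * h) - f (real i * h)) / (real (Suc i) * h - real i * h) * (x - real i * h))\<bar>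
        \<le> 2 * L * (real (Suc i) * h - real i * h) powr \<beta>"
      using h xi xSi grid[of "Suc i"] iJ by (intro holder_interpolation_error[OF f \<beta> L]) auto
    moreover have "real (Suc i) * h - real i * h = h" by (simp add: algebra_simps)
    ultimately have "\<bar>f x - (F i + (F (Suc i) - F i) / h * (x - real i * h))\<bar> \<le> 2 * L * h powr \<beta>"
      by (simp only: F_def)
    moreover have "F 0 = f 0" by (simp add: F_def)
    ultimately show ?thesis unfolding eq h_def[symmetric] by linarith
  qed
  show thesis
  proof (rule that[of v])
    show "\<bar>v k\<bar> \<le> 4 * L * real J" if "k < J * q" for k by (rule v_bound[OF that])
    show "v k = 0" if "\<not> q dvd k" for k using that by (simp add: v_def)
    fix w :: "nat \<Rightarrow> real" and b \<delta> e x :: real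
    assume w: "\<And>k. k < J * q \<Longrightarrow> \<bar>w k - v k\<bar> \<le> \<delta>" and b: "\<bar>b - f 0\<bar> \<le> e" and x: "x \<in> {0..1}"
    have "\<bar>(\<Sum>k<J * q. (w k - v k) * max (x - real k / real (J * q)) 0)\<bar>
        \<le> (\<Sum>k<J * q. \<bar>(w k - v k) * max (x - real k / real (J * q)) 0\<bar>)"
      by (rule sum_abs)
    also have "\<dots> \<le> (\<Sum>k<J * q. \<delta>)"
    proof (rule sum_mono)
      fix k assume "k \<in> {..<J * q}"
      then have "\<bar>w k - v k\<bar> \<le> \<delta>" using w by simp
      moreover have "\<bar>max (x - d) 0\<bar> \<le> 1" if "0 \<le> d" for d using x that by (auto simp: max_def)
      then have "\<bar>max (x - real k / real (J * q)) 0\<bar> \<le> 1" by simp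
      ultimately have "\<bar>w k - v k\<bar> * \<bar>max (x - real k / real (J * q)) 0\<bar> \<le> \<delta> * 1"
        by (intro mult_mono) auto
      then show "\<bar>(w k - v k) * max (x - real k / real (J * q)) 0\<bar> \<le> \<delta>" by (simp add: abs_mult)
    qed
    finally have "\<bar>(\<Sum>k<J * q. (w k - v k) * max (x - real k / real (J * q)) 0)\<bar> \<le> real (J * q) * \<delta>"
      by simp
    moreover have "shallow_net (J * q) w b x - f x = (\<Sum>k<J * q. (w k - v k) * max (x - real k / real (J * q)) 0)
        + (b - f 0) + ((\<Sum>k<J * q. v k * max (x - real k / real (J * q)) 0) + f 0 - f x)"
      unfolding shallow_net_def by (simp add: sum_subtractf left_diff_distrib)
    ultimately show "\<bar>shallow_net (J * q) w b x - f x\<bar> \<le> real (J * q) * \<delta> + e + 2 * L * (1 / real J) powr \<beta>"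
      using spline[OF x] b by linarith
  qed
qed

text \<open>The width is a power of two, hence divisible by every smaller one. Rounding
  \<open>\<gamma> * l\<close> down loses at most a factor \<open>2\<close> against
  \<open>n powr \<gamma>\<close>, and this exponent does not exceed that of the width, since
  \<open>floor\<close> is at most \<open>round\<close>.\<close>

lemma net_width_factor:
  assumes n: "1 \<le> n" and \<gamma>: "0 \<le> \<gamma>" "\<gamma> \<le> 1"
  obtains J q where "net_width 0 n = J * q" "0 < J" "0 < q"
    "real J \<le> real n powr \<gamma>" "real n powr \<gamma> \<le> 2 * real J"
proof -
  define l where "l = log 2 (real n)"
  have l: "0 \<le> l" using n by (simp add: l_def)
  define m where "m = nat (round l)"
  define j where "j = nat \<lfloor>\<gamma> * l\<rfloor>"
  have "\<gamma> * l \<le> l" using \<gamma> l by (simp add: mult_left_le_one_le)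
  then have "\<lfloor>\<gamma> * l\<rfloor> \<le> round l" using floor_mono floor_le_round order_trans by blast
  then have jm: "j \<le> m" by (simp add: j_def m_def nat_mono)
  have pow: "real n powr \<gamma> = 2 powr (\<gamma> * l)"
    using n by (simp add: l_def powr_powr[symmetric] mult.commute[of \<gamma>])
  have "0 \<le> \<gamma> * l" using \<gamma> l by simp
  then have j: "real j \<le> \<gamma> * l" "\<gamma> * l \<le> real j + 1" unfolding j_def by linarith+
  have J: "real (2 ^ j) = 2 powr real j" by (simp add: powr_realpow)
  show thesis
  proof (rule that[of "2 ^ j" "2 ^ (m - j)"])
    show "net_width 0 n = 2 ^ j * 2 ^ (m - j)"
      using jm n by (simp add: net_width_def m_def l_def power_add[symmetric])
    show "real (2 ^ j) \<le> real n powr \<gamma>" unfolding J pow using j by simp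
    have "2 powr (\<gamma> * l) \<le> 2 powr (real j + 1)" using j by (intro powr_mono) auto
    then show "real n powr \<gamma> \<le> 2 * real (2 ^ j)" unfolding J pow by (simp add: powr_add)
  qed auto
qed

lemma net_width_le: "1 \<le> n \<Longrightarrow> real (net_width 0 n) \<le> 2 * real n"
proof -
  assume n: "1 \<le> n"
  define l where "l = log 2 (real n)"
  have "0 \<le> l" using n by (simp add: l_def)
  then have "0 \<le> round l" by (metis round_0 round_mono)
  then have "real (nat (round l)) \<le> l + 1" using of_int_round_le[of l] by linarith
  then have "2 powr real (nat (round l)) \<le> 2 powr (l + 1)" by (intro powr_mono) auto
  then show ?thesis using n by (simp add: net_width_def l_def powr_add powr_realpow)
qed

lemma measure_density_Icc_ge:
  fixes g :: "real \<Rightarrow> real"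
  assumes "prob_space (density lborel (\<lambda>u. ennreal (g u)))" and [measurable]: "g \<in> borel_measurable borel"
    and g: "\<And>u. u \<in> {a..b} \<Longrightarrow> c \<le> g u" and "0 \<le> c" "a \<le> b"
  shows "c * (b - a) \<le> measure (density lborel (\<lambda>u. ennreal (g u))) {a..b}"
proof -
  interpret prob_space "density lborel (\<lambda>u. ennreal (g u))" by fact
  have "ennreal (c * (b - a)) = (\<integral>\<^sup>+u. ennreal c * indicator {a..b} u \<partial>lborel)"
    using assms by (simp add: nn_integral_cmult_indicator ennreal_mult')
  also have "\<dots> \<le> (\<integral>\<^sup>+u. ennreal (g u) * indicator {a..b} u \<partial>lborel)"
    using g by (intro nn_integral_mono) (auto simp: indicator_def intro!: ennreal_leI)
  also have "\<dots> = emeasure (density lborel (\<lambda>u. ennreal (g u))) {a..b}"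
    by (subst emeasure_density) auto
  finally show ?thesis by (simp add: emeasure_eq_measure)
qed

text \<open>The set \<open>I k\<close> consists of the \<open>\<zeta> k\<close> whose scaled weight
  is within \<open>x powr (- 3 / 2)\<close> of \<open>v k\<close>. Each of the at most
  \<open>J\<close> indices divisible by \<open>q\<close> costs a factor \<open>x powr (- K)\<close>;
  all the others together cost at most a factor \<open>1 / 2\<close>.\<close>

lemma prior_box_mass:
  fixes n :: nat and t :: real and v :: "nat \<Rightarrow> real" and B :: "real measure"
  defines "x \<equiv> real n"
  defines "K \<equiv> exp (2 * (t + 2)) / 2 + 1"
  defines "I \<equiv> \<lambda>k. {(v k - x powr (- 3 / 2)) / x powr (- t)..(v k + x powr (- 3 / 2)) / x powr (- t)}"
  assumes x: "8 \<le> x" and t: "5 / 2 < t" and N: "N = J * q" "0 < q" "real N \<le> 2 * x"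
    and v: "\<And>k. k < N \<Longrightarrow> \<bar>v k\<bar> \<le> V" "\<And>k. \<not> q dvd k \<Longrightarrow> v k = 0" and V: "V + 1 \<le> x\<^sup>2"
  shows "x powr (- K * real J) / 2 \<le> measure (PiM {..<N} (\<lambda>_. p_exp_law (2 / ln x))) (PiE {..<N} I)"
proof -
  define P where "P = p_exp_law (2 / ln x)"
  interpret P: prob_space P unfolding P_def by (rule prob_space_p_exp_law[OF x refl])
  interpret PS: finite_product_prob_space "\<lambda>_. P" "{..<N}" by standard auto
  have I_sets: "I k \<in> sets P" for k by (simp add: P_def p_exp_law_def I_def)
  have center: "1 - 1 / x\<^sup>2 \<le> P.prob (I k)" if "\<not> q dvd k" for k
  proof -
    \<comment> \<open>As \<open>t > 5 / 2\<close>, the half-width \<open>x powr (t - 3 / 2)\<close>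
      is at least \<open>x\<close>; around the target \<open>0\<close> the interval thus contains
      \<open>{-x..x}\<close>.\<close>
    have "x = x powr 1" using x by simp
    also have "\<dots> \<le> x powr (- 3 / 2 - - t)" using x t by (intro powr_mono) auto
    finally have "x \<le> x powr (- 3 / 2) / x powr (- t)" by (simp only: powr_diff)
    then have "{-x..x} \<subseteq> I k" using v(2)[OF that] by (auto simp: I_def)
    then have "P.prob {-x..x} \<le> P.prob (I k)" by (intro P.finite_measure_mono I_sets)
    then show ?thesis using p_exp_law_tail[OF x refl] by (simp add: P_def)
  qed
  have off: "x powr (- K) \<le> P.prob (I k)" if k: "k < N" for k
  proof -
    \<comment> \<open>The endpoints of \<open>I k\<close> are at most
      \<open>x\<^sup>2 / x powr (- t)\<close> in size. The first summand of \<open>K\<close> is the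
      exponent from \<open>pexp_lower\<close> at this \<open>?s\<close>; the summand
      \<open>1\<close> absorbs the factor \<open>1 / 2\<close> left by the length, at least
      \<open>2 * x\<close>, over the bound \<open>4 * x\<close> on the normalising constant.\<close>
    let ?s = "t + 2"
    define a b where "a = (v k - x powr (- 3 / 2)) / x powr (- t)" and "b = (v k + x powr (- 3 / 2)) / x powr (- t)"
    have "x powr (- 3 / 2) \<le> x powr 0" using x by (intro powr_mono) auto
    then have small: "x powr (- 3 / 2) \<le> 1" using x by simp
    have abs: "\<bar>a\<bar> \<le> x powr ?s" "\<bar>b\<bar> \<le> x powr ?s"
    proof -
      have *: "\<bar>u / x powr (- t)\<bar> \<le> x powr ?s" if "\<bar>u\<bar> \<le> V + 1" for u
      proof -
        have "\<bar>u / x powr (- t)\<bar> = \<bar>u\<bar> * x powr t" using x by (simp add: powr_minus field_simps abs_mult)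
        also have "\<dots> \<le> x\<^sup>2 * x powr t" using that V by (intro mult_right_mono) auto
        also have "\<dots> = x powr ?s" using x by (simp add: powr_add)
        finally show ?thesis .
      qed
      have "\<bar>x powr (- 3 / 2)\<bar> \<le> 1" using small by simp
      then have "\<bar>v k - x powr (- 3 / 2)\<bar> \<le> V + 1" and "\<bar>v k + x powr (- 3 / 2)\<bar> \<le> V + 1"
        using v(1)[OF k] by linarith+
      then show "\<bar>a\<bar> \<le> x powr ?s" "\<bar>b\<bar> \<le> x powr ?s" unfolding a_def b_def by (simp_all only: *)
    qed
    have ba: "b - a = 2 * x powr (- 3 / 2 - - t)"
      unfolding powr_diff a_def b_def by (simp add: diff_divide_distrib[symmetric])
    have "x powr 1 \<le> x powr (- 3 / 2 - - t)" using x t by (intro powr_mono) auto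
    then have ba: "2 * x \<le> b - a" unfolding ba using x by simp
    have "x powr (- K) = x powr (- exp (2 * ?s) / 2) * x powr (- 1)"
      unfolding powr_add[symmetric] by (simp add: K_def)
    also have "\<dots> \<le> x powr (- exp (2 * ?s) / 2) * (1 / 2)"
      using x by (intro mult_left_mono) (auto simp: powr_minus field_simps)
    also have "\<dots> = (2 * x) * (x powr (- exp (2 * ?s) / 2) / (4 * x))" using x by simp
    also have "\<dots> \<le> (b - a) * (x powr (- exp (2 * ?s) / 2) / (4 * x))"
      using ba x by (intro mult_right_mono) auto
    also have "\<dots> \<le> P.prob {a..b}"
      unfolding P_def using ba x abs by (intro p_exp_law_interval[OF x refl]) auto
    finally show ?thesis by (simp add: I_def a_def b_def)
  qed
  let ?D = "{k\<in>{..<N}. q dvd k}"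
  have card_D: "card ?D \<le> J"
  proof -
    have "?D \<subseteq> (\<lambda>l. l * q) ` {..<J}"
    proof
      fix k assume "k \<in> ?D"
      then have "k = k div q * q" "k div q < J" using N by (auto simp: less_mult_imp_div_less)
      then show "k \<in> (\<lambda>l. l * q) ` {..<J}" by blast
    qed
    then show ?thesis using surj_card_le[of "{..<J}" ?D "\<lambda>l. l * q"] by simp
  qed
  have "1 / x\<^sup>2 \<le> 1" using x by (simp add: power_le_one_iff)
  have "x powr (- K * real J) / 2 = (x powr (- K)) ^ J * (1 / 2)"
  proof -
    have "x powr (- K * real J) = (x powr (- K)) powr real J" by (simp add: powr_powr)
    also have "\<dots> = (x powr (- K)) ^ J" using x by (simp add: powr_realpow)
    finally show ?thesis by simp
  qed
  also have "\<dots> \<le> (x powr (- K)) ^ card ?D * (1 - 1 / x\<^sup>2) ^ N"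
  proof (rule mult_mono)
    have "0 < K" by (simp add: K_def add_pos_pos)
    then have "x powr (- K) \<le> x powr 0" using x by (intro powr_mono) auto
    then show "(x powr (- K)) ^ J \<le> (x powr (- K)) ^ card ?D"
      using card_D x by (intro power_decreasing) auto
    \<comment> \<open>Bernoulli's inequality reduces the product over the inactive weights to
      \<open>1 - N / x\<^sup>2\<close>, which is at least \<open>1 - 2 / x\<close>.\<close>
    have "1 / 2 \<le> 1 + real N * (- 1 / x\<^sup>2)"
    proof -
      have "real N * (1 / x\<^sup>2) \<le> 2 * x * (1 / x\<^sup>2)" using N by (intro mult_right_mono) auto
      also have "\<dots> \<le> 1 / 2" using x by (simp add: power2_eq_square field_simps)
      finally show ?thesis by simp
    qed
    also have "\<dots> \<le> (1 + - 1 / x\<^sup>2) ^ N"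
      using \<open>1 / x\<^sup>2 \<le> 1\<close> by (intro Bernoulli_inequality) simp
    finally show "1 / 2 \<le> (1 - 1 / x\<^sup>2) ^ N" by simp
  qed auto
  also have "\<dots> \<le> (x powr (- K)) ^ card ?D * (1 - 1 / x\<^sup>2) ^ card {k\<in>{..<N}. \<not> q dvd k}"
  proof (intro mult_left_mono power_decreasing)
    have "card {k\<in>{..<N}. \<not> q dvd k} \<le> card {..<N}" by (intro card_mono) auto
    then show "card {k\<in>{..<N}. \<not> q dvd k} \<le> N" by simp
  qed (use \<open>1 / x\<^sup>2 \<le> 1\<close> in auto)
  also have "\<dots> = (\<Prod>k\<in>?D. x powr (- K)) * (\<Prod>k\<in>{k\<in>{..<N}. \<not> q dvd k}. 1 - 1 / x\<^sup>2)" by simp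
  also have "\<dots> \<le> (\<Prod>k\<in>?D. P.prob (I k)) * (\<Prod>k\<in>{k\<in>{..<N}. \<not> q dvd k}. P.prob (I k))"
    using \<open>1 / x\<^sup>2 \<le> 1\<close> by (intro mult_mono prod_mono prod_nonneg) (auto intro: off center)
  also have "\<dots> = (\<Prod>k\<in>?D \<union> {k\<in>{..<N}. \<not> q dvd k}. P.prob (I k))"
    by (rule prod.union_disjoint[symmetric]) auto
  also have "?D \<union> {k\<in>{..<N}. \<not> q dvd k} = {..<N}" by auto
  also have "(\<Prod>k<N. P.prob (I k)) = measure (PiM {..<N} (\<lambda>_. P)) (PiE {..<N} I)"
    by (rule PS.prob_times[symmetric]) (use I_sets in auto)
  finally show ?thesis by (simp add: P_def)
qed

text \<open>The set is a box of weights times an interval of biases around \<open>f0 0\<close>,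
  which is where a net must start since all its ramps vanish at \<open>0\<close>. The number of
  active weights is at most \<open>n powr \<gamma>\<close>, and each costs a fixed power of
  \<open>n\<close>.\<close>

lemma prior_mass:
  fixes f0 g :: "real \<Rightarrow> real" and \<beta> L t :: real
  assumes f: "f0 \<in> holder_ball \<beta> L" and \<beta>: "0 < \<beta>" "\<beta> \<le> 2" and L: "0 < L" and t: "5 / 2 < t"
    and g: "prob_space (density lborel (\<lambda>u. ennreal (g u)))" "continuous_on UNIV g" "\<And>u. 0 < g u"
  defines "M \<equiv> \<lambda>n. PiM {..<net_width 0 n} (\<lambda>_. p_exp_law (2 / ln (real n)))
      \<Otimes>\<^sub>M density lborel (\<lambda>u. ennreal (g u))"
  obtains K C where "0 < K" "0 < C"
    "\<forall>\<^sub>F n in sequentially. \<exists>A\<in>sets (M n).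
       exp (- K * (real n powr (1 / (1 + 2 * \<beta>)) * ln (real n))) \<le> measure (M n) A \<and>
       (\<forall>(\<zeta>, b)\<in>A. \<forall>y\<in>{0..1}. \<bar>shallow_net (net_width 0 n) (\<lambda>k. real n powr (- t) * \<zeta> k) b y - f0 y\<bar>
          \<le> C * real n powr (- \<beta> / (1 + 2 * \<beta>)))"
proof -
  define K0 where "K0 = exp (2 * (t + 2)) / 2 + 1"
  have K0: "0 < K0" by (simp add: K0_def add_pos_pos)
  define \<gamma> where "\<gamma> = 1 / (1 + 2 * \<beta>)"
  have \<gamma>: "0 \<le> \<gamma>" "\<gamma> \<le> 1" using \<beta> by (auto simp: \<gamma>_def)
  have \<gamma>\<beta>: "- \<beta> / (1 + 2 * \<beta>) = - (\<gamma> * \<beta>)" by (simp add: \<gamma>_def)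
  have \<gamma>\<beta>_le: "\<gamma> * \<beta> \<le> 1 / 2" "0 \<le> \<gamma> * \<beta>" using \<beta> by (auto simp: \<gamma>_def field_simps)
  have [measurable]: "g \<in> borel_measurable borel" using g(2) by (rule borel_measurable_continuous_onI)
  \<comment> \<open>The minimum of the bias density over a fixed compact interval is positive; the
    bias intervals used below have half-width \<open>e \<le> 1\<close> and lie inside it.\<close>
  obtain u0 where u0: "\<And>u. u \<in> {f0 0 - 1..f0 0 + 1} \<Longrightarrow> g u0 \<le> g u"
    using continuous_attains_inf[of "{f0 0 - 1..f0 0 + 1}" g] continuous_on_subset[OF g(2)]
    by (auto simp: Ball_def)
  define c where "c = g u0"
  have c: "0 < c" using g by (simp add: c_def)
  interpret B: prob_space "density lborel (\<lambda>u. ennreal (g u))" by fact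
  \<comment> \<open>\<open>K0\<close> is the exponent per active weight; the summand
    \<open>2\<close> pays, through \<open>x powr (- 2) \<le> c * e\<close>, for the bias. In
    \<open>3 + 8 * L\<close> the weights account for \<open>2\<close>, the bias for
    \<open>1\<close>, and the interpolation for \<open>2 * L * 2 powr \<beta> \<le> 8 * L\<close>,
    the power of \<open>2\<close> coming from \<open>x powr \<gamma> \<le> 2 * J\<close>.\<close>
  show thesis
  proof (rule that[of "K0 + 2" "3 + 8 * L"])
    have "\<forall>\<^sub>F n in sequentially. max 8 (max (4 * L + 1) (1 / c)) \<le> real n"
      by real_asymp
    then show "\<forall>\<^sub>F n in sequentially. \<exists>A\<in>sets (M n).
       exp (- (K0 + 2) * (real n powr (1 / (1 + 2 * \<beta>)) * ln (real n))) \<le> measure (M n) A \<and>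
       (\<forall>(\<zeta>, b)\<in>A. \<forall>y\<in>{0..1}. \<bar>shallow_net (net_width 0 n) (\<lambda>k. real n powr (- t) * \<zeta> k) b y - f0 y\<bar>
          \<le> (3 + 8 * L) * real n powr (- \<beta> / (1 + 2 * \<beta>)))"
    proof eventually_elim
      case (elim n)
      define x where "x = real n"
      have x: "8 \<le> x" "4 * L + 1 \<le> x" "1 / c \<le> x" using elim by (auto simp: x_def)
      have n: "1 \<le> n" using x by (simp add: x_def)
      define N where "N = net_width 0 n"
      have N: "real N \<le> 2 * x" unfolding N_def x_def by (rule net_width_le[OF n])
      obtain J q where Jq: "N = J * q" "0 < J" "0 < q" "real J \<le> x powr \<gamma>" "x powr \<gamma> \<le> 2 * real J"
        unfolding N_def x_def by (rule net_width_factor[OF n \<gamma>])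
      obtain v where v: "\<And>k. k < N \<Longrightarrow> \<bar>v k\<bar> \<le> 4 * L * real J" "\<And>k. \<not> q dvd k \<Longrightarrow> v k = 0"
        and approx: "\<And>w b \<delta> e y. (\<And>k. k < N \<Longrightarrow> \<bar>w k - v k\<bar> \<le> \<delta>) \<Longrightarrow> \<bar>b - f0 0\<bar> \<le> e \<Longrightarrow> y \<in> {0..1} \<Longrightarrow>
          \<bar>shallow_net N w b y - f0 y\<bar> \<le> real N * \<delta> + e + 2 * L * (1 / real J) powr \<beta>"
        using shallow_net_approx[OF f \<beta> L Jq(2,3)] unfolding Jq(1)[symmetric] by blast
      have x\<gamma>: "x powr \<gamma> \<le> x" "1 \<le> x powr \<gamma>"
        using powr_mono[of \<gamma> 1 x] ge_one_powr_ge_zero[of x \<gamma>] x \<gamma> by auto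
      have V: "4 * L * real J + 1 \<le> x\<^sup>2"
      proof -
        have "4 * L * real J + 1 \<le> 4 * L * x + x" using L Jq x\<gamma> x by (intro add_mono mult_left_mono) auto
        also have "\<dots> = (4 * L + 1) * x" by (simp add: algebra_simps)
        also have "\<dots> \<le> x * x" using x by (intro mult_right_mono) auto
        finally show ?thesis by (simp add: power2_eq_square)
      qed
      define \<sigma> where "\<sigma> = x powr (- t)"
      have \<sigma>: "0 < \<sigma>" using x by (simp add: \<sigma>_def)
      define \<delta> where "\<delta> = x powr (- 3 / 2)"
      define e where "e = x powr (- (\<gamma> * \<beta>))"
      have e: "e \<le> 1" "x powr (- 1 / 2) \<le> e" "1 / x \<le> e" "0 < e"
        using powr_mono[of "- (\<gamma> * \<beta>)" 0 x] powr_mono[of "- 1 / 2" "- (\<gamma> * \<beta>)" x]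
          powr_mono[of "- 1" "- (\<gamma> * \<beta>)" x] \<gamma>\<beta>_le x
        by (auto simp: e_def powr_minus_divide)
      define I where "I k = {(v k - \<delta>) / \<sigma>..(v k + \<delta>) / \<sigma>}" for k
      define A where "A = PiE {..<N} I \<times> {f0 0 - e..f0 0 + e}"
      define W where "W = PiM {..<N} (\<lambda>_. p_exp_law (2 / ln x))"
      have M: "M n = W \<Otimes>\<^sub>M density lborel (\<lambda>u. ennreal (g u))"
        by (simp add: M_def W_def N_def x_def)
      have I_sets: "PiE {..<N} I \<in> sets W"
        unfolding W_def by (intro sets_PiM_I_finite) (auto simp: I_def p_exp_law_def)
      have A_sets: "A \<in> sets (M n)"
        unfolding M A_def by (intro pair_measureI I_sets) simp
      have "x powr (- K0 * real J) / 2 \<le> measure W (PiE {..<N} I)"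
        using prior_box_mass[of n t N J q v "4 * L * real J"] x t Jq N v V
        by (simp add: K0_def W_def I_def[abs_def] \<sigma>_def \<delta>_def x_def)
      moreover have "c * (2 * e) \<le> measure (density lborel (\<lambda>u. ennreal (g u))) {f0 0 - e..f0 0 + e}"
        using measure_density_Icc_ge[OF g(1), of "f0 0 - e" "f0 0 + e" c] u0 c e
        by (simp add: c_def)
      ultimately have "x powr (- K0 * real J) / 2 * (c * (2 * e)) \<le>
          measure W (PiE {..<N} I) * measure (density lborel (\<lambda>u. ennreal (g u))) {f0 0 - e..f0 0 + e}"
        using c e by (intro mult_mono) auto
      also have "\<dots> = measure (M n) A"
        unfolding M A_def using I_sets
        by (simp add: measure_def B.emeasure_pair_measure_Times enn2real_mult)
      finally have mass: "x powr (- K0 * real J) / 2 * (c * (2 * e)) \<le> measure (M n) A" .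
      have "exp (- (K0 + 2) * (x powr \<gamma> * ln x)) \<le> x powr (- K0 * real J) * x powr (- 2)"
      proof -
        have "K0 * real J + 2 \<le> (K0 + 2) * x powr \<gamma>"
          using mult_left_mono[OF Jq(4) less_imp_le[OF K0]] x\<gamma> unfolding distrib_right by linarith
        then have "(K0 * real J + 2) * ln x \<le> (K0 + 2) * x powr \<gamma> * ln x"
          using x by (intro mult_right_mono) auto
        then have "- (K0 + 2) * (x powr \<gamma> * ln x) \<le> (- K0 * real J + - 2) * ln x"
          by (simp add: algebra_simps)
        then show ?thesis using x unfolding powr_add[symmetric] by (simp add: powr_def)
      qed
      also have "\<dots> \<le> x powr (- K0 * real J) * (c * e)"
      proof (intro mult_left_mono)
        have "1 / x * (1 / x) \<le> c * e"
          using x e c by (intro mult_mono) (auto simp: field_simps)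
        then show "x powr (- 2) \<le> c * e" using x by (simp add: powr_minus_divide power2_eq_square)
      qed simp
      finally have "exp (- (K0 + 2) * (x powr \<gamma> * ln x)) \<le> measure (M n) A" using mass by simp
      moreover have "\<bar>shallow_net N (\<lambda>k. \<sigma> * \<zeta> k) b y - f0 y\<bar> \<le> (3 + 8 * L) * e"
        if "(\<zeta>, b) \<in> A" "y \<in> {0..1}" for \<zeta> b y
      proof -
        have "\<bar>\<sigma> * \<zeta> k - v k\<bar> \<le> \<delta>" if k: "k < N" for k
        proof -
          have "\<zeta> k \<in> I k" using \<open>(\<zeta>, b) \<in> A\<close> k by (auto simp: A_def)
          then have "v k - \<delta> \<le> \<sigma> * \<zeta> k" "\<sigma> * \<zeta> k \<le> v k + \<delta>" using \<sigma> by (auto simp: I_def field_simps)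
          then show ?thesis by linarith
        qed
        moreover have "b \<in> {f0 0 - e..f0 0 + e}" using \<open>(\<zeta>, b) \<in> A\<close> unfolding A_def by blast
        then have "\<bar>b - f0 0\<bar> \<le> e" unfolding abs_le_iff atLeastAtMost_iff by linarith
        ultimately have "\<bar>shallow_net N (\<lambda>k. \<sigma> * \<zeta> k) b y - f0 y\<bar> \<le> real N * \<delta> + e + 2 * L * (1 / real J) powr \<beta>"
          using \<open>y \<in> {0..1}\<close> by (intro approx) auto
        also have "\<dots> \<le> 2 * e + e + 2 * L * (4 * e)"
        proof (intro add_mono mult_left_mono)
          have "x * \<delta> = x powr (1 + - 3 / 2)" unfolding \<delta>_def powr_add using x by simp
          then have x\<delta>: "2 * x * \<delta> = 2 * x powr (- 1 / 2)" by simp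
          have "real N * \<delta> \<le> 2 * x * \<delta>" using N by (intro mult_right_mono) (auto simp: \<delta>_def)
          also have "\<dots> = 2 * x powr (- 1 / 2)" by (rule x\<delta>)
          also have "\<dots> \<le> 2 * e" using e by simp
          finally show "real N * \<delta> \<le> 2 * e" .
          have "1 / real J \<le> 2 * x powr (- \<gamma>)"
            using Jq x by (simp add: powr_minus_divide field_simps)
          then have "(1 / real J) powr \<beta> \<le> (2 * x powr (- \<gamma>)) powr \<beta>"
            using \<beta> by (intro powr_mono2) auto
          also have "\<dots> = 2 powr \<beta> * e" by (simp add: powr_mult powr_powr e_def)
          also have "\<dots> \<le> 2 powr 2 * e" using \<beta> e by (intro mult_right_mono powr_mono) auto
          finally show "(1 / real J) powr \<beta> \<le> 4 * e" by simp
        qed (use L in auto)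
        finally show ?thesis by (simp add: algebra_simps)
      qed
      ultimately show ?case
        using A_sets unfolding \<gamma>\<beta> \<gamma>_def[symmetric] x_def[symmetric] N_def[symmetric] e_def[symmetric] \<sigma>_def[symmetric]
        by (intro bexI[of _ A]) auto
    qed
  qed (use K0 L in auto)
qed

section \<open>Contraction of the posterior\<close>

context design
begin

lemma borel_measurable_design: "f \<in> borel_measurable borel \<Longrightarrow> f \<in> borel_measurable PX"
  unfolding measurable_cong_sets[OF sets_design refl] by (rule measurable_restrict_space1)

lemma measurable_shallow_net: "shallow_net N w b \<in> borel_measurable PX"
  unfolding shallow_net_def[abs_def] by (rule borel_measurable_design) measurable

text \<open>The posterior is pulled back to the parameters, where joint measurability with the data
  is available. Dividing the likelihood by that of \<open>f0\<close> multiplies numerator and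
  denominator by the same factor, and \<open>expected_posterior_le\<close> applies.\<close>

lemma expected_rho_posterior_le:
  fixes N n :: nat and \<sigma> \<rho> \<eta> a V l :: real and P B :: "real measure" and f0 :: "real \<Rightarrow> real"
  defines "W \<equiv> PiM {..<N} (\<lambda>_. P) \<Otimes>\<^sub>M B"
  defines "T \<equiv> \<lambda>(\<zeta>, b). shallow_net N (\<lambda>k. \<sigma> * \<zeta> k) b"
  assumes P: "prob_space P" and setsP[measurable_cong]: "sets P = sets borel"
    and B: "prob_space B" and setsB[measurable_cong]: "sets B = sets borel"
    and f0[measurable]: "f0 \<in> borel_measurable PX" and \<rho>: "0 < \<rho>"
    and A: "A \<in> sets W" "a \<le> measure W A" "0 < a"
    and close: "\<And>\<theta> y. \<theta> \<in> A \<Longrightarrow> y \<in> {0..1} \<Longrightarrow> \<bar>T \<theta> y - f0 y\<bar> \<le> \<eta>"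
    and V: "\<And>f. f \<in> borel_measurable PX \<Longrightarrow> f \<in> S \<Longrightarrow>
      (\<integral>\<^sup>+Z. ennreal (exp (\<rho> * (loglik n Z f - loglik n Z f0))) \<partial>sample_law PX n f0) \<le> ennreal V" "0 \<le> V"
    and l: "0 < l"
  shows "(LINT Z|sample_law PX n f0. rho_posterior (image_measure W T) \<rho> n Z S)
      \<le> (l * V + exp (real n * ((\<rho>\<^sup>2 + \<rho>) / 2 * \<eta>\<^sup>2)) / (l * a)) / 2" (is ?le)
    and "0 \<le> (LINT Z|sample_law PX n f0. rho_posterior (image_measure W T) \<rho> n Z S)" (is ?nonneg)
proof -
  interpret P: prob_space P by fact
  interpret B: prob_space B by fact
  have W: "prob_space W" unfolding W_def by (intro prob_space_pair prob_space_PiM P B)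
  interpret W: prob_space W by fact
  have T_meas [measurable]: "T \<theta> \<in> borel_measurable PX" for \<theta>
    unfolding T_def by (simp add: case_prod_beta measurable_shallow_net)
  define r where "r \<theta> Z = exp (\<rho> * (loglik n Z (T \<theta>) - loglik n Z f0))" for \<theta> Z
  have id_meas [measurable]: "(\<lambda>x. x) \<in> borel_measurable PX" by (rule borel_measurable_design) simp
  have [measurable_cong]: "sets W = sets (PiM {..<N} (\<lambda>_. borel) \<Otimes>\<^sub>M borel)"
    unfolding W_def by (intro sets_pair_measure_cong sets_PiM_cong setsP setsB refl)
  have [measurable]: "(\<lambda>(\<theta>, Z). loglik n Z (T \<theta>)) \<in> borel_measurable (W \<Otimes>\<^sub>M sample_law PX n f0)"
    unfolding loglik_def T_def shallow_net_def case_prod_beta by measurable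
  have r_meas: "(\<lambda>(\<theta>, Z). r \<theta> Z) \<in> borel_measurable (W \<Otimes>\<^sub>M sample_law PX n f0)"
    unfolding r_def by measurable
  have int: "integrable W (\<lambda>\<theta>. r \<theta> Z)" if Z: "Z \<in> space (sample_law PX n f0)" for Z
  proof (rule W.integrable_const_bound[where B = "exp (- \<rho> * loglik n Z f0)"])
    \<comment> \<open>The log-likelihood is minus a sum of squares, which bounds the ratio by a
      constant in \<open>\<theta>\<close>.\<close>
    have "loglik n Z (T \<theta>) \<le> 0" for \<theta> by (simp add: loglik_def sum_nonneg)
    then have "r \<theta> Z \<le> exp (- \<rho> * loglik n Z f0)" for \<theta>
      using \<rho> by (simp add: r_def right_diff_distrib mult_nonneg_nonpos)
    then show "AE \<theta> in W. norm (r \<theta> Z) \<le> exp (- \<rho> * loglik n Z f0)" by (simp add: r_def)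
    show "(\<lambda>\<theta>. r \<theta> Z) \<in> borel_measurable W" using measurable_Pair1[OF r_meas Z] by simp
  qed
  have eq: "rho_posterior (image_measure W T) \<rho> n Z S
      = (LINT \<theta>|W. indicator (T -` S) \<theta> * r \<theta> Z) / (LINT \<theta>|W. r \<theta> Z)" for Z
  proof -
    have r: "r \<theta> Z = exp (\<rho> * loglik n Z (T \<theta>)) * exp (- \<rho> * loglik n Z f0)" for \<theta>
      by (simp add: r_def exp_add[symmetric] right_diff_distrib)
    have "(LINT \<theta>|W. indicator (T -` S) \<theta> * r \<theta> Z)
        = (LINT \<theta>|W. indicator S (T \<theta>) * exp (\<rho> * loglik n Z (T \<theta>))) * exp (- \<rho> * loglik n Z f0)"
      unfolding r by (subst integral_mult_left_zero[symmetric]) (simp add: indicator_def mult.assoc)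
    moreover have "(LINT \<theta>|W. r \<theta> Z) = (LINT \<theta>|W. exp (\<rho> * loglik n Z (T \<theta>))) * exp (- \<rho> * loglik n Z f0)"
      unfolding r by (rule integral_mult_left_zero)
    ultimately show ?thesis
      by (simp add: rho_posterior_def set_lebesgue_integral_def integral_image_measure)
  qed
  have U: "(\<integral>\<^sup>+Z. ennreal (1 / r \<theta> Z) \<partial>sample_law PX n f0)
      \<le> ennreal (exp (real n * ((\<rho>\<^sup>2 + \<rho>) / 2 * \<eta>\<^sup>2)))" if \<theta>: "\<theta> \<in> A" for \<theta>
  proof -
    have "(\<integral>\<^sup>+Z. ennreal (1 / r \<theta> Z) \<partial>sample_law PX n f0)
        = (\<integral>\<^sup>+Z. ennreal (exp (- \<rho> * (loglik n Z (T \<theta>) - loglik n Z f0))) \<partial>sample_law PX n f0)"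
      by (simp add: r_def exp_minus inverse_eq_divide)
    \<comment> \<open>The inverse ratio is the case \<open>c = - \<rho>\<close>, whose exponent is
      positive; it is controlled only because \<open>T \<theta>\<close> is uniformly close to
      \<open>f0\<close>.\<close>
    also have "\<dots> = (\<integral>\<^sup>+x. ennreal (exp (((- \<rho>)\<^sup>2 - - \<rho>) / 2 * (T \<theta> x - f0 x)\<^sup>2)) \<partial>PX) ^ n"
      by (rule nn_integral_loglik_diff) measurable
    also have "\<dots> \<le> (\<integral>\<^sup>+x. ennreal (exp ((\<rho>\<^sup>2 + \<rho>) / 2 * \<eta>\<^sup>2)) \<partial>PX) ^ n"
    proof (intro power_mono nn_integral_mono ennreal_leI)
      fix x assume "x \<in> space PX"
      then have "\<bar>T \<theta> x - f0 x\<bar> \<le> \<eta>" using close[OF \<theta>] by (simp add: space_design)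
      then have "(T \<theta> x - f0 x)\<^sup>2 \<le> \<eta>\<^sup>2" by (metis abs_ge_zero power2_abs power_mono)
      then show "exp (((- \<rho>)\<^sup>2 - - \<rho>) / 2 * (T \<theta> x - f0 x)\<^sup>2) \<le> exp ((\<rho>\<^sup>2 + \<rho>) / 2 * \<eta>\<^sup>2)"
        using \<rho> by (simp add: mult_left_mono)
    qed simp
    also have "\<dots> = ennreal (exp (real n * ((\<rho>\<^sup>2 + \<rho>) / 2 * \<eta>\<^sup>2)))"
      unfolding exp_of_nat_mult by (simp add: emeasure_space_1 ennreal_power)
    finally show ?thesis .
  qed
  note post = expected_posterior_le[OF W prob_space_sample_law[OF f0] r_meas _ int A U _ _ V(2) l, where B = "T -` S"]
  show ?le unfolding eq
    by (rule post(1)) (auto simp: r_def intro!: V)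
  show ?nonneg unfolding eq
    by (rule post(2)) (auto simp: r_def intro!: V)
qed

text \<open>Clipping moves \<open>f\<close> closer to \<open>f0\<close> and bounds the difference, so that
  \<open>exp (- y) \<le> 1 / (1 + y)\<close> can be bounded by a linear function of the squared difference.\<close>

lemma clipped_affinity_le:
  assumes [measurable]: "f \<in> borel_measurable PX" "f0 \<in> borel_measurable PX"
    and F: "\<And>x. x \<in> {0..1} \<Longrightarrow> \<bar>f0 x\<bar> \<le> F" and c: "0 < c"
  shows "(\<integral>\<^sup>+x. ennreal (exp (- c * (f x - f0 x)\<^sup>2)) \<partial>PX)
    \<le> ennreal (exp (- (c / (1 + 4 * c * F\<^sup>2)) * (L2_norm_wrt PX (\<lambda>x. clip F f x - f0 x))\<^sup>2))"
proof -
  define k where "k = c / (1 + 4 * c * F\<^sup>2)"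
  define d where "d x = clip F f x - f0 x" for x
  have [measurable]: "d \<in> borel_measurable PX" unfolding d_def clip_def by measurable
  have "0 < 1 + 4 * c * F\<^sup>2" using c by (intro add_pos_nonneg) auto
  have d: "(d x)\<^sup>2 \<le> (f x - f0 x)\<^sup>2" "(d x)\<^sup>2 \<le> 4 * F\<^sup>2" if "x \<in> space PX" for x
  proof -
    have f0x: "\<bar>f0 x\<bar> \<le> F" using F that by (simp add: space_design)
    \<comment> \<open>Clipping projects onto \<open>{-F..F}\<close>, which contains
      \<open>f0 x\<close> and has diameter \<open>2 * F\<close>.\<close>
    have "\<bar>d x\<bar> \<le> \<bar>f x - f0 x\<bar>" "\<bar>d x\<bar> \<le> \<bar>2 * F\<bar>"
      using f0x by (auto simp: d_def clip_def max_def min_def)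
    from this[THEN abs_le_square_iff[THEN iffD1]]
    show "(d x)\<^sup>2 \<le> (f x - f0 x)\<^sup>2" "(d x)\<^sup>2 \<le> 4 * F\<^sup>2" by (simp_all add: power_mult_distrib)
  qed
  have int: "integrable PX (\<lambda>x. (d x)\<^sup>2)"
    by (rule integrable_const_bound[where B = "4 * F\<^sup>2"]) (use d(2) in auto)
  have pw: "exp (- c * (f x - f0 x)\<^sup>2) \<le> 1 - k * (d x)\<^sup>2" if x: "x \<in> space PX" for x
  proof -
    define y where "y = c * (d x)\<^sup>2"
    have y: "0 \<le> y" "y \<le> 4 * c * F\<^sup>2" using c d(2)[OF x] by (auto simp: y_def)
    have "exp (- c * (f x - f0 x)\<^sup>2) \<le> exp (- y)" using c d(1)[OF x] by (simp add: y_def)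
    also have "\<dots> \<le> 1 / (1 + y)"
      using exp_ge_add_one_self[of y] y by (simp add: exp_minus inverse_eq_divide frac_le)
    also have "\<dots> = 1 - y / (1 + y)" using y by (simp add: field_simps)
    also have "\<dots> \<le> 1 - y / (1 + 4 * c * F\<^sup>2)"
      using y by (intro diff_left_mono divide_left_mono) auto
    also have "\<dots> = 1 - k * (d x)\<^sup>2" by (simp add: y_def k_def)
    finally show ?thesis .
  qed
  have pos: "0 \<le> 1 - k * (d x)\<^sup>2" if "x \<in> space PX" for x
    using pw[OF that] by (rule order_trans[OF exp_ge_zero])
  have "(\<integral>\<^sup>+x. ennreal (exp (- c * (f x - f0 x)\<^sup>2)) \<partial>PX) \<le> (\<integral>\<^sup>+x. ennreal (1 - k * (d x)\<^sup>2) \<partial>PX)"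
    by (intro nn_integral_mono ennreal_leI pw)
  also have "\<dots> = ennreal (LINT x|PX. 1 - k * (d x)\<^sup>2)"
    using int pos by (intro nn_integral_eq_integral) auto
  also have "(LINT x|PX. 1 - k * (d x)\<^sup>2) = 1 - k * (LINT x|PX. (d x)\<^sup>2)"
    using int by (simp add: prob_space)
  also have "(LINT x|PX. (d x)\<^sup>2) = (L2_norm_wrt PX d)\<^sup>2"
    by (simp add: L2_norm_wrt_def)
  \<comment> \<open>Returning to exponential form lets the \<open>n\<close>-th power over the sample
    simply multiply the exponent by \<open>n\<close>.\<close>
  also have "ennreal (1 - k * (L2_norm_wrt PX d)\<^sup>2) \<le> ennreal (exp (- k * (L2_norm_wrt PX d)\<^sup>2))"
    using exp_ge_add_one_self[of "- k * (L2_norm_wrt PX d)\<^sup>2"] by (intro ennreal_leI) simp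
  finally show ?thesis unfolding k_def d_def .
qed

end

theorem theorem5:
  fixes \<beta> L t \<rho> :: real
    and f0 \<pi>b :: "real \<Rightarrow> real"
    and PX :: "real measure"
    and prior :: "nat \<Rightarrow> (real \<Rightarrow> real) measure"
  assumes "0 < \<beta>" "\<beta> \<le> 2" "0 < L"
    and "f0 \<in> holder_ball \<beta> L"
    and "prob_space PX" "sets PX = sets (restrict_space borel {0..1})"
    and "prob_space (density lborel (\<lambda>u. ennreal (\<pi>b u)))"
    and "continuous_on UNIV \<pi>b" "\<And>u. 0 < \<pi>b u" "\<And>u. \<pi>b (- u) = \<pi>b u"
    and "5 / 2 < t"
    and "\<And>n. prior n = shallow_prior 0 n (real n powr (- t)) (p_exp_law (2 / ln (real n)))
                       (density lborel (\<lambda>u. ennreal (\<pi>b u)))"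
    and "0 < \<rho>" "\<rho> < 1"
  shows "(\<exists>M>0. \<forall>\<epsilon> :: nat \<Rightarrow> real.
           (\<forall>n\<ge>8. real n powr (- \<beta> / (1 + 2 * \<beta>)) * sqrt (ln (real n)) \<le> \<epsilon> n) \<longrightarrow>
           (\<lambda>n. LINT Z|sample_law PX n f0.
                  rho_posterior (prior n) \<rho> n Z
                    {f. 1 / real n * renyi_div \<rho> (sample_law PX n f) (sample_law PX n f0)
                          \<ge> M * (\<epsilon> n)\<^sup>2}) \<longlonglongrightarrow> 0)
       \<and> (\<forall>F>0. (\<forall>x\<in>{0..1}. \<bar>f0 x\<bar> \<le> F) \<longrightarrow>
           (\<exists>M'>0. \<forall>\<epsilon> :: nat \<Rightarrow> real.
             (\<forall>n\<ge>8. real n powr (- \<beta> / (1 + 2 * \<beta>)) * sqrt (ln (real n)) \<le> \<epsilon> n) \<longrightarrow>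
             (\<lambda>n. LINT Z|sample_law PX n f0.
                    clipped_rho_posterior F (prior n) \<rho> n Z
                      {f. L2_norm_wrt PX (\<lambda>x. f x - f0 x) \<ge> M' * \<epsilon> n}) \<longlonglongrightarrow> 0))"
proof -
  note \<beta> = assms(1,2) and \<rho> = assms(13,14)
  interpret design PX by (rule design.intro[OF assms(5,6)])
  have f0 [measurable]: "f0 \<in> borel_measurable PX"
    unfolding measurable_cong_sets[OF sets_design refl]
    by (rule borel_measurable_continuous_on_restrict[OF holder_ball_continuous_on[OF assms(4,1,2)]])
  let ?B = "density lborel (\<lambda>u. ennreal (\<pi>b u))"
  define \<gamma> where "\<gamma> = 1 / (1 + 2 * \<beta>)"
  have \<gamma>: "0 < \<gamma>" using \<beta> by (simp add: \<gamma>_def)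
  \<comment> \<open>Thus \<open>n\<close> times the squared rate without logarithm is
    \<open>n powr \<gamma>\<close>, the order of the number of active weights.\<close>
  have rate: "\<gamma> = 1 + 2 * (- \<beta> / (1 + 2 * \<beta>))" using \<beta> by (simp add: \<gamma>_def field_simps)
  obtain K C where K: "0 < K" and C: "0 < C" and mass: "\<forall>\<^sub>F n in sequentially.
      \<exists>A\<in>sets (PiM {..<net_width 0 n} (\<lambda>_. p_exp_law (2 / ln (real n))) \<Otimes>\<^sub>M ?B).
       exp (- K * (real n powr (1 / (1 + 2 * \<beta>)) * ln (real n)))
         \<le> measure (PiM {..<net_width 0 n} (\<lambda>_. p_exp_law (2 / ln (real n))) \<Otimes>\<^sub>M ?B) A \<and>
       (\<forall>(\<zeta>, b)\<in>A. \<forall>y\<in>{0..1}. \<bar>shallow_net (net_width 0 n) (\<lambda>k. real n powr (- t) * \<zeta> k) b y - f0 y\<bar>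
          \<le> C * real n powr (- \<beta> / (1 + 2 * \<beta>)))"
    by (rule prior_mass[OF assms(4) \<beta> assms(3,11,7,8,9)])
  \<comment> \<open>With \<open>l = exp ((K + C\<^sup>2 + 1) * R)\<close> below, half of
    \<open>m\<close> cancels \<open>l\<close> in the numerator term and half remains as decay. In
    the other term \<open>l\<close> beats both the inverse prior mass (\<open>K\<close>) and the
    likelihood cost (\<open>C\<^sup>2\<close>), leaving one further factor
    \<open>exp (- R0)\<close>.\<close>
  define m where "m = 2 * (K + C\<^sup>2 + 1)"
  have m: "0 < m" using K by (simp add: m_def add_pos_nonneg)
  \<comment> \<open>Both claims reduce to one exponential bound on the expected ratio for functions
    in \<open>S n\<close>. Since \<open>m\<close> is fixed before \<open>\<epsilon>\<close>, the
    constants derived from it serve all admissible rates.\<close>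
  have core: "(\<lambda>n. LINT Z|sample_law PX n f0. rho_posterior (prior n) \<rho> n Z (S n)) \<longlonglongrightarrow> 0"
    if \<epsilon>: "\<forall>n\<ge>8. real n powr (- \<beta> / (1 + 2 * \<beta>)) * sqrt (ln (real n)) \<le> \<epsilon> n"
      and V: "\<And>n f. 8 \<le> n \<Longrightarrow> 0 \<le> \<epsilon> n \<Longrightarrow> f \<in> borel_measurable PX \<Longrightarrow> f \<in> S n \<Longrightarrow>
        (\<integral>\<^sup>+Z. ennreal (exp (\<rho> * (loglik n Z f - loglik n Z f0))) \<partial>sample_law PX n f0)
          \<le> ennreal (exp (- m * (real n * (\<epsilon> n)\<^sup>2)))"
    for \<epsilon> :: "nat \<Rightarrow> real" and S
  proof (rule tendsto_sandwich[OF _ _ tendsto_const])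
    have "\<forall>\<^sub>F n in sequentially. 8 \<le> n" by (rule eventually_ge_at_top)
    with mass have ev: "\<forall>\<^sub>F n in sequentially.
      0 \<le> (LINT Z|sample_law PX n f0. rho_posterior (prior n) \<rho> n Z (S n)) \<and>
      (LINT Z|sample_law PX n f0. rho_posterior (prior n) \<rho> n Z (S n)) \<le> exp (- (real n powr \<gamma> * ln (real n)))"
    proof eventually_elim
      case (elim n)
      define x where "x = real n"
      have x: "8 \<le> x" using elim by (simp add: x_def)
      have lnx: "1 \<le> ln x"
      proof -
        have "exp 1 \<le> x" using exp_le x by linarith
        then show ?thesis using x by (simp add: ln_ge_iff)
      qed
      obtain A where A: "A \<in> sets (PiM {..<net_width 0 n} (\<lambda>_. p_exp_law (2 / ln x)) \<Otimes>\<^sub>M ?B)"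
        "exp (- K * (x powr \<gamma> * ln x)) \<le> measure (PiM {..<net_width 0 n} (\<lambda>_. p_exp_law (2 / ln x)) \<Otimes>\<^sub>M ?B) A"
        and close: "\<And>\<zeta> b y. (\<zeta>, b) \<in> A \<Longrightarrow> y \<in> {0..1} \<Longrightarrow>
          \<bar>shallow_net (net_width 0 n) (\<lambda>k. x powr (- t) * \<zeta> k) b y - f0 y\<bar> \<le> C * x powr (- \<beta> / (1 + 2 * \<beta>))"
        using elim(1) unfolding x_def[symmetric] \<gamma>_def[symmetric] by fastforce
      define e where "e = x powr (- \<beta> / (1 + 2 * \<beta>))"
      define R0 where "R0 = x powr \<gamma> * ln x"
      define R where "R = x * (\<epsilon> n)\<^sup>2"
      have xe: "x * e\<^sup>2 = x powr \<gamma>"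
      proof -
        have "x powr \<gamma> = x powr 1 * (e * e)" unfolding rate e_def by (simp only: powr_add mult_2)
        then show ?thesis using x by (simp add: power2_eq_square)
      qed
      have \<epsilon>n: "e * sqrt (ln x) \<le> \<epsilon> n" using \<epsilon> elim by (simp add: e_def x_def)
      have "0 \<le> e * sqrt (ln x)" using lnx by (simp add: e_def)
      then have \<epsilon>0: "0 \<le> \<epsilon> n" using \<epsilon>n by linarith
      have "(e * sqrt (ln x))\<^sup>2 \<le> (\<epsilon> n)\<^sup>2" using \<epsilon>n \<open>0 \<le> e * sqrt (ln x)\<close> by (rule power_mono)
      then have "x * (e\<^sup>2 * ln x) \<le> R"
        unfolding R_def using x lnx by (intro mult_left_mono) (auto simp: power_mult_distrib)
      then have R: "R0 \<le> R" unfolding R0_def xe[symmetric] by (simp add: mult.assoc)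
      have "x powr \<gamma> * 1 \<le> R0" unfolding R0_def using lnx by (intro mult_left_mono) auto
      then have xR: "x powr \<gamma> \<le> R0" by simp
      define l where "l = exp ((K + C\<^sup>2 + 1) * R)"
      have "0 < l" by (simp add: l_def)
      have p: "prob_space (p_exp_law (2 / ln x))" by (rule prob_space_p_exp_law[OF x refl])
      have prior: "prior n = image_measure (PiM {..<net_width 0 n} (\<lambda>_. p_exp_law (2 / ln x)) \<Otimes>\<^sub>M ?B)
          (\<lambda>(\<zeta>, b). shallow_net (net_width 0 n) (\<lambda>k. x powr (- t) * \<zeta> k) b)"
        by (simp add: assms(12) shallow_prior_def x_def)
      note bound = expected_rho_posterior_le[OF p _ assms(7) _ f0 \<rho>(1) A exp_gt_zero _ V[OF elim(2) \<epsilon>0] exp_ge_zero \<open>0 < l\<close>,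
          where \<eta> = "C * e" and \<sigma> = "x powr (- t)"]
      have nonneg: "0 \<le> (LINT Z|sample_law PX n f0. rho_posterior (prior n) \<rho> n Z (S n))"
        unfolding prior by (rule bound(2)) (use close in \<open>auto simp: p_exp_law_def e_def\<close>)
      have "(LINT Z|sample_law PX n f0. rho_posterior (prior n) \<rho> n Z (S n))
          \<le> (l * exp (- m * (real n * (\<epsilon> n)\<^sup>2)) + exp (real n * ((\<rho>\<^sup>2 + \<rho>) / 2 * (C * e)\<^sup>2)) / (l * exp (- K * (x powr \<gamma> * ln x)))) / 2"
        unfolding prior by (rule bound(1)) (use close in \<open>auto simp: p_exp_law_def e_def\<close>)
      also have "\<dots> \<le> (exp (- R0) + exp (- R0)) / 2"
      proof (intro divide_right_mono add_mono)
        have "l * exp (- m * (real n * (\<epsilon> n)\<^sup>2)) = exp (- ((K + C\<^sup>2 + 1) * R))"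
          unfolding l_def exp_add[symmetric] m_def R_def x_def by (simp add: algebra_simps)
        also have "\<dots> \<le> exp (- R0)"
        proof -
          have "0 \<le> R" using powr_ge_zero[of x \<gamma>] xR R by linarith
          then have "1 * R \<le> (K + C\<^sup>2 + 1) * R" using K by (intro mult_right_mono) auto
          then show ?thesis using R by simp
        qed
        finally show "l * exp (- m * (real n * (\<epsilon> n)\<^sup>2)) \<le> exp (- R0)" .
        have "\<rho>\<^sup>2 \<le> 1" using \<rho> by (simp add: power_le_one)
        then have "(\<rho>\<^sup>2 + \<rho>) / 2 * (C\<^sup>2 * x powr \<gamma>) \<le> 1 * (C\<^sup>2 * x powr \<gamma>)"
          using \<rho> by (intro mult_right_mono) auto
        also have "\<dots> \<le> C\<^sup>2 * R0" using xR by (simp add: mult_left_mono)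
        finally have le: "(\<rho>\<^sup>2 + \<rho>) / 2 * (C\<^sup>2 * x powr \<gamma>) \<le> C\<^sup>2 * R0" .
        have U: "real n * ((\<rho>\<^sup>2 + \<rho>) / 2 * (C * e)\<^sup>2) \<le> C\<^sup>2 * R0"
        proof -
          have "real n * ((\<rho>\<^sup>2 + \<rho>) / 2 * (C * e)\<^sup>2) = (\<rho>\<^sup>2 + \<rho>) / 2 * (C\<^sup>2 * x powr \<gamma>)"
            unfolding xe[symmetric] power_mult_distrib by (simp add: x_def)
          then show ?thesis using le by (simp only:)
        qed
        have "exp (real n * ((\<rho>\<^sup>2 + \<rho>) / 2 * (C * e)\<^sup>2)) / (l * exp (- K * (x powr \<gamma> * ln x)))
            = exp (real n * ((\<rho>\<^sup>2 + \<rho>) / 2 * (C * e)\<^sup>2) - ((K + C\<^sup>2 + 1) * R + - K * R0))"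
          by (simp only: l_def R0_def exp_diff exp_add)
        also have "\<dots> \<le> exp (- R0)"
        proof -
          have "(K + C\<^sup>2 + 1) * R0 \<le> (K + C\<^sup>2 + 1) * R" using K R by (intro mult_left_mono) auto
          moreover have "(K + C\<^sup>2 + 1) * R0 = K * R0 + C\<^sup>2 * R0 + R0" by (simp add: algebra_simps)
          ultimately show ?thesis using U unfolding exp_le_cancel_iff by linarith
        qed
        finally show "exp (real n * ((\<rho>\<^sup>2 + \<rho>) / 2 * (C * e)\<^sup>2)) / (l * exp (- K * (x powr \<gamma> * ln x))) \<le> exp (- R0)" .
      qed simp
      finally show ?case using nonneg by (simp add: R0_def x_def)
    qed
    show "\<forall>\<^sub>F n in sequentially. 0 \<le> (LINT Z|sample_law PX n f0. rho_posterior (prior n) \<rho> n Z (S n))"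
      using ev by eventually_elim simp
    show "\<forall>\<^sub>F n in sequentially. (LINT Z|sample_law PX n f0. rho_posterior (prior n) \<rho> n Z (S n))
        \<le> exp (- (real n powr \<gamma> * ln (real n)))"
      using ev by eventually_elim simp
    show "(\<lambda>n. exp (- (real n powr \<gamma> * ln (real n)))) \<longlonglongrightarrow> 0" using \<gamma> by real_asymp
  qed
  show ?thesis
  proof (intro conjI allI impI)
    show "\<exists>M>0. \<forall>\<epsilon> :: nat \<Rightarrow> real.
           (\<forall>n\<ge>8. real n powr (- \<beta> / (1 + 2 * \<beta>)) * sqrt (ln (real n)) \<le> \<epsilon> n) \<longrightarrow>
           (\<lambda>n. LINT Z|sample_law PX n f0.
                  rho_posterior (prior n) \<rho> n Z
                    {f. 1 / real n * renyi_div \<rho> (sample_law PX n f) (sample_law PX n f0)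
                          \<ge> M * (\<epsilon> n)\<^sup>2}) \<longlonglongrightarrow> 0"
    \<comment> \<open>The denominator cancels the factor \<open>1 - \<rho>\<close> in the exponent
      of \<open>nn_integral_loglik_renyi\<close>.\<close>
    proof (intro exI[of _ "m / (1 - \<rho>)"] conjI allI impI core)
      fix \<epsilon> :: "nat \<Rightarrow> real" and n f
      assume n: "8 \<le> n" and [measurable]: "f \<in> borel_measurable PX"
        and f: "f \<in> {f. 1 / real n * renyi_div \<rho> (sample_law PX n f) (sample_law PX n f0) \<ge> m / (1 - \<rho>) * (\<epsilon> n)\<^sup>2}"
      have "m * (real n * (\<epsilon> n)\<^sup>2) \<le> (1 - \<rho>) * renyi_div \<rho> (sample_law PX n f) (sample_law PX n f0)"
        using f n \<rho> by (simp add: field_simps)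
      then show "(\<integral>\<^sup>+Z. ennreal (exp (\<rho> * (loglik n Z f - loglik n Z f0))) \<partial>sample_law PX n f0)
          \<le> ennreal (exp (- m * (real n * (\<epsilon> n)\<^sup>2)))"
        by (subst nn_integral_loglik_renyi)
           (auto intro!: ennreal_leI \<rho> simp del: minus_diff_eq)
    qed (use m \<rho> in auto)
  next
    fix F :: real assume F: "0 < F" "\<forall>x\<in>{0..1}. \<bar>f0 x\<bar> \<le> F"
    \<comment> \<open>This is minus the exponent \<open>(\<rho>\<^sup>2 - \<rho>) / 2\<close> of
      \<open>nn_integral_loglik_diff\<close>.\<close>
    define c where "c = \<rho> * (1 - \<rho>) / 2"
    have c: "0 < c" using \<rho> by (simp add: c_def)
    define k where "k = c / (1 + 4 * c * F\<^sup>2)"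
    have k: "0 < k" using c by (auto simp: k_def intro!: divide_pos_pos add_pos_nonneg)
    show "\<exists>M'>0. \<forall>\<epsilon> :: nat \<Rightarrow> real.
             (\<forall>n\<ge>8. real n powr (- \<beta> / (1 + 2 * \<beta>)) * sqrt (ln (real n)) \<le> \<epsilon> n) \<longrightarrow>
             (\<lambda>n. LINT Z|sample_law PX n f0.
                    clipped_rho_posterior F (prior n) \<rho> n Z
                      {f. L2_norm_wrt PX (\<lambda>x. f x - f0 x) \<ge> M' * \<epsilon> n}) \<longlonglongrightarrow> 0"
      unfolding clipped_rho_posterior_def
    \<comment> \<open>Squaring the distance bound gives
      \<open>k * ?d\<^sup>2 \<ge> m * (\<epsilon> n)\<^sup>2\<close>, where \<open>k\<close> is the
      decay constant of \<open>clipped_affinity_le\<close>.\<close>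
    proof (intro exI[of _ "sqrt (m / k)"] conjI allI impI core)
      fix \<epsilon> :: "nat \<Rightarrow> real" and n f
      assume \<epsilon>: "0 \<le> \<epsilon> n" and [measurable]: "f \<in> borel_measurable PX"
        and f: "f \<in> clip F -` {f. L2_norm_wrt PX (\<lambda>x. f x - f0 x) \<ge> sqrt (m / k) * \<epsilon> n}"
      let ?d = "L2_norm_wrt PX (\<lambda>x. clip F f x - f0 x)"
      have "(sqrt (m / k) * \<epsilon> n)\<^sup>2 \<le> ?d\<^sup>2"
        using f \<epsilon> m k by (intro power_mono) auto
      then have d: "m * (\<epsilon> n)\<^sup>2 \<le> k * ?d\<^sup>2"
        using m k by (simp add: power_mult_distrib field_simps)
      have "(\<integral>\<^sup>+Z. ennreal (exp (\<rho> * (loglik n Z f - loglik n Z f0))) \<partial>sample_law PX n f0)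
          = (\<integral>\<^sup>+x. ennreal (exp ((\<rho>\<^sup>2 - \<rho>) / 2 * (f x - f0 x)\<^sup>2)) \<partial>PX) ^ n"
        by (rule nn_integral_loglik_diff) measurable
      also have "(\<rho>\<^sup>2 - \<rho>) / 2 = - c" by (simp add: c_def power2_eq_square field_simps)
      also have "(\<integral>\<^sup>+x. ennreal (exp (- c * (f x - f0 x)\<^sup>2)) \<partial>PX) ^ n \<le> ennreal (exp (- k * ?d\<^sup>2)) ^ n"
        unfolding k_def using F c by (intro power_mono clipped_affinity_le) auto
      also have "\<dots> = ennreal (exp (- (real n * (k * ?d\<^sup>2))))"
        by (simp add: ennreal_power exp_of_nat_mult[symmetric])
      also have "\<dots> \<le> ennreal (exp (- m * (real n * (\<epsilon> n)\<^sup>2)))"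
        using mult_left_mono[OF d, of "real n"] by (intro ennreal_leI) (simp add: algebra_simps)
      finally show "(\<integral>\<^sup>+Z. ennreal (exp (\<rho> * (loglik n Z f - loglik n Z f0))) \<partial>sample_law PX n f0)
          \<le> ennreal (exp (- m * (real n * (\<epsilon> n)\<^sup>2)))" .
    qed (use m k in auto)
  qed
qed

end
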